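(* Let $p>1$. For $h\in(0,1)$ let $a_h(x)=1$ for $x\in[0,\tfrac{1-h}{2}]\cup[\tfrac{1+h}{2},1]$ and $a_h(x)=0$ for $x\in(\tfrac{1-h}{2},\tfrac{1+h}{2})$, and for $\lambda<\pi^2$ consider $$-u''=\lambda u+a_h(x)u^p \ \text{ in } (0,1),\qquad u(0)=u(1)=0,$$ which for each such $(\lambda,h)$ has a unique symmetric positive solution. Then for every $\alpha>0$ there exist increasing sequences $\{h_n\}_{n\geq1}\subset(0,1)$ and $\{\lambda_n\}_{n\geq1}\subset(0,\pi^2)$ such that $\lim_{n\to\infty}h_n=1$, $\lim_{n\to\infty}\lambda_n=\pi^2$, and $\|u_{\lambda_n}\|_\infty=\alpha$ for all $n\geq1$, where $u_{\lambda_n}$ is the unique symmetric positive solution of the problem with $(\lambda,h)=(\lambda_n,h_n)$. Moreover, $\lim_{n\to\infty}u_{\lambda_n}=\alpha\sin(\pi\,\cdot)$ in $\mathcal{C}^1([0,1];\mathbb{R})$.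
   Context: A solution is a function $u\in\mathcal{C}^1([0,1])$ with $u'$ absolutely continuous satisfying the equation a.e. and the boundary conditions; a positive solution satisfies $u>0$ in $(0,1)$; a solution is symmetric if $u(x)=u(1-x)$ for all $x\in[0,1]$. *)

theory Defs
  imports "HOL-Analysis.Analysis"
begin

definition abs_continuous_on :: "real \<Rightarrow> real \<Rightarrow> (real \<Rightarrow> real) \<Rightarrow> bool" where
  "abs_continuous_on a b f \<longleftrightarrow>
     (\<forall>\<epsilon>>0. \<exists>\<delta>>0. \<forall>(n::nat) (s::nat \<Rightarrow> real) (t::nat \<Rightarrow> real).
        (\<forall>i<n. a \<le> s i \<and> s i \<le> t i \<and> t i \<le> b) \<and>
        (\<forall>i<n. \<forall>j<n. i \<noteq> j \<longrightarrow> t i \<le> s j \<or> t j \<le> s i) \<and>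
        (\<Sum>i<n. t i - s i) < \<delta>
        \<longrightarrow> (\<Sum>i<n. \<bar>f (t i) - f (s i)\<bar>) < \<epsilon>)"

definition a_h :: "real \<Rightarrow> real \<Rightarrow> real" where
  "a_h h x = (if (1 - h) / 2 < x \<and> x < (1 + h) / 2 then 0 else 1)"

definition is_solution :: "real \<Rightarrow> real \<Rightarrow> real \<Rightarrow> (real \<Rightarrow> real) \<Rightarrow> bool" where
  "is_solution p lam h u \<longleftrightarrow>
     (\<exists>u'. (\<forall>x\<in>{0..1}. (u has_real_derivative u' x) (at x within {0..1})) \<and>
           continuous_on {0..1} u' \<and>
           abs_continuous_on 0 1 u' \<and>
           (AE x in lebesgue. x \<in> {0<..<1} \<longrightarrow>
              (u' has_real_derivative (- (lam * u x + a_h h x * (u x) powr p))) (at x))) \<and>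
     u 0 = 0 \<and> u 1 = 0"

definition is_sym_pos_solution :: "real \<Rightarrow> real \<Rightarrow> real \<Rightarrow> (real \<Rightarrow> real) \<Rightarrow> bool" where
  "is_sym_pos_solution p lam h u \<longleftrightarrow>
     is_solution p lam h u \<and> (\<forall>x\<in>{0<..<1}. u x > 0) \<and> (\<forall>x\<in>{0..1}. u x = u (1 - x))"

end

theory Submission
  imports Defs
begin

text \<open>
  Write \<open>u = \<alpha> z\<close> with \<open>z (1/2) = 1\<close>. Where \<open>a_h\<close> vanishes, symmetry forces
  \<open>z x = cos (sqrt l (1/2 - x))\<close>; on the outer interval conservation of energy turns the equation into
  the first-order equation \<open>z' = sqrt (slope_sq z)\<close>, so \<open>z\<close> is the inverse of the travel time
  \<open>\<integral> 1 / sqrt slope_sq\<close>. A solution with height \<open>k = cos (sqrt l h / 2)\<close> at the interface exists as soon as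
  the travel time to height \<open>k\<close> is the length \<open>(1 - h) / 2\<close> of the outer interval.

  Uniqueness: a larger amplitude gives a larger slope at every height below \<open>k\<close>, hence a shorter
  travel time, whereas the interval to be crossed is fixed.

  To prescribe the amplitude \<open>\<alpha>\<close>, fix \<open>k\<close> and find \<open>l\<close> with
  \<open>arccos k / sqrt l + travel_time k = 1/2\<close> by the intermediate value theorem on
  \<open>[(2 arccos k)\<^sup>2, pi\<^sup>2]\<close>. As \<open>k\<close> tends to \<open>0\<close> this forces \<open>l\<close> to \<open>pi\<^sup>2\<close> and \<open>h\<close> to \<open>1\<close>, and the slope
  is explicit enough to give uniform convergence of the derivative.
\<close>

subsection \<open>Absolutely continuous functions\<close>

lemma abs_continuous_onE:
  assumes "abs_continuous_on a b f" and "e > 0"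
  obtains d where "d > 0"
    and "\<And>(n::nat) s t. \<lbrakk>\<And>i. i < n \<Longrightarrow> a \<le> s i \<and> s i \<le> t i \<and> t i \<le> b;
        \<And>i j. \<lbrakk>i < n; j < n; i \<noteq> j\<rbrakk> \<Longrightarrow> t i \<le> s j \<or> t j \<le> s i;
        (\<Sum>i<n. t i - s i) < d\<rbrakk> \<Longrightarrow> (\<Sum>i<n. \<bar>f (t i) - f (s i)\<bar>) < e"
proof -
  obtain d where "d > 0" and d: "\<forall>(n::nat) s t.
        (\<forall>i<n. a \<le> s i \<and> s i \<le> t i \<and> t i \<le> b) \<and>
        (\<forall>i<n. \<forall>j<n. i \<noteq> j \<longrightarrow> t i \<le> s j \<or> t j \<le> s i) \<and>
        (\<Sum>i<n. t i - s i) < d \<longrightarrow> (\<Sum>i<n. \<bar>f (t i) - f (s i)\<bar>) < e"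
    using assms(1)[unfolded abs_continuous_on_def, rule_format, OF assms(2)] by (elim exE conjE)
  show thesis
  proof (rule that[OF \<open>d > 0\<close>])
    fix n :: nat and s t :: "nat \<Rightarrow> real"
    assume "\<And>i. i < n \<Longrightarrow> a \<le> s i \<and> s i \<le> t i \<and> t i \<le> b"
      and "\<And>i j. \<lbrakk>i < n; j < n; i \<noteq> j\<rbrakk> \<Longrightarrow> t i \<le> s j \<or> t j \<le> s i"
      and "(\<Sum>i<n. t i - s i) < d"
    then show "(\<Sum>i<n. \<bar>f (t i) - f (s i)\<bar>) < e"
      by (intro d[THEN spec, THEN spec, THEN spec, THEN mp]) simp
  qed
qed

lemma abs_continuous_onI:
  assumes "\<And>e. e > 0 \<Longrightarrow> \<exists>d>0. \<forall>(n::nat) s t.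
        (\<forall>i<n. a \<le> s i \<and> s i \<le> t i \<and> t i \<le> b) \<longrightarrow>
        (\<forall>i<n. \<forall>j<n. i \<noteq> j \<longrightarrow> t i \<le> s j \<or> t j \<le> s i) \<longrightarrow>
        (\<Sum>i<n. t i - s i) < d \<longrightarrow> (\<Sum>i<n. \<bar>f (t i) - f (s i)\<bar>) < e"
  shows "abs_continuous_on a b f"
  using assms unfolding abs_continuous_on_def by (simp only: imp_conjL) simp

text \<open>A gauge argument. Intervals tagged in the exceptional null set are forced into an open
  set of measure below the \<open>d\<close> supplied by absolute continuity, so together they change
  \<open>F\<close> by less than \<open>e\<close>. At every other tag the increment over an interval
  is at most \<open>e\<close> times its length. Hence \<open>\<bar>F b - F a\<bar>\<close> is at
  most \<open>e * (b - a + 1)\<close> for every \<open>e > 0\<close>.\<close>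

lemma abs_continuous_on_deriv_zero:
  fixes F :: "real \<Rightarrow> real"
  assumes ac: "abs_continuous_on a b F" and "a \<le> b" and N: "negligible N"
    and der: "\<And>x. x \<in> {a<..<b} - N \<Longrightarrow> (F has_real_derivative 0) (at x)"
  shows "F b = F a"
proof -
  have bound: "\<bar>F b - F a\<bar> \<le> e * (b - a + 1)" if e: "e > 0" for e
  proof -
    obtain d where d: "d > 0" and acd: "\<And>(n::nat) s t.
        \<lbrakk>\<And>i. i < n \<Longrightarrow> a \<le> s i \<and> s i \<le> t i \<and> t i \<le> b;
        \<And>i j. \<lbrakk>i < n; j < n; i \<noteq> j\<rbrakk> \<Longrightarrow> t i \<le> s j \<or> t j \<le> s i;
        (\<Sum>i<n. t i - s i) < d\<rbrakk> \<Longrightarrow> (\<Sum>i<n. \<bar>F (t i) - F (s i)\<bar>) < e"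
      using abs_continuous_onE[OF ac e] by blast
    \<comment> \<open>The endpoints join the exceptional set because \<open>der\<close> speaks only
      of interior points.\<close>
    define N' where "N' = insert a (insert b N)"
    have negN': "negligible N'"
      using N by (simp add: N'_def)
    then have N'null: "N' \<in> null_sets lebesgue"
      by (simp add: negligible_iff_null_sets)
    then obtain U where U: "open U" "N' \<subseteq> U" "U - N' \<in> lmeasurable"
        "emeasure lebesgue (U - N') < ennreal d"
      using sets_lebesgue_outer_open[of N' d] d by blast
    have Um: "U \<in> lmeasurable"
    proof -
      have "U = (U - N') \<union> N'" using U(2) by blast
      then show ?thesis
        using U(3) negligible_imp_measurable[OF negN'] by (metis fmeasurable.Un)
    qed
    have Ud: "measure lebesgue U < d"
    proof -
      have "emeasure lebesgue (U - N') = emeasure lebesgue U"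
        using N'null by (rule emeasure_Diff_null_set) (use Um in auto)
      then have "emeasure lebesgue U < ennreal d" using U(4) by simp
      then show ?thesis
        using Um d by (metis emeasure_eq_measure2 ennreal_less_iff measure_nonneg)
    qed
    have "\<exists>r>0. \<forall>y. \<bar>y - x\<bar> < r \<longrightarrow> \<bar>F y - F x\<bar> \<le> e * \<bar>y - x\<bar>" if "x \<in> {a<..<b} - N" for x
    proof -
      have "(F has_derivative (\<lambda>h. 0)) (at x)"
        using der[OF that] has_field_derivative_imp_has_derivative by (force simp flip: lambda_zero)
      then show ?thesis
        using e unfolding has_derivative_within_alt by (auto simp: dist_real_def)
    qed
    then obtain r where r: "\<And>x. x \<in> {a<..<b} - N \<Longrightarrow> r x > 0"
      "\<And>x y. x \<in> {a<..<b} - N \<Longrightarrow> \<bar>y - x\<bar> < r x \<Longrightarrow> \<bar>F y - F x\<bar> \<le> e * \<bar>y - x\<bar>"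
      by metis
    \<comment> \<open>Every tag lies in \<open>{a..b}\<close>, hence in \<open>N'\<close> or in
      \<open>{a<..<b} - N\<close>; the value \<open>UNIV\<close> only makes \<open>\<gamma>\<close>
      total.\<close>
    define \<gamma> where "\<gamma> x = (if x \<in> N' then U else if x \<in> {a<..<b} - N then ball x (r x) else UNIV)" for x
    have "gauge \<gamma>"
      using U(1,2) r(1) by (auto simp: gauge_def \<gamma>_def)
    then obtain P where P: "P tagged_division_of {a..b}" "\<gamma> fine P"
      using fine_division_exists_real by blast
    have finP: "finite P" using P(1) by blast
    have PK: "\<exists>u v. K = {u..v} \<and> u \<le> x \<and> x \<le> v \<and> a \<le> u \<and> v \<le> b" if "(x, K) \<in> P" for x K
    proof -
      have "x \<in> K" "K \<subseteq> {a..b}" "\<exists>u v. K = cbox u v"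
        using tagged_division_ofD(2-4)[OF P(1) that] by auto
      then obtain u v where "K = {u..v}" by auto
      with \<open>x \<in> K\<close> \<open>K \<subseteq> {a..b}\<close> show ?thesis by auto
    qed
    \<comment> \<open>Degenerate intervals are left out: their increment is zero, and a single point
      inside another interval would violate the ordering of endpoints demanded by absolute
      continuity.\<close>
    define P1 where "P1 = {z \<in> P. fst z \<in> N' \<and> Inf (snd z) < Sup (snd z)}"
    have finP1: "finite P1" using finP by (simp add: P1_def)
    have P1P: "P1 \<subseteq> P" by (auto simp: P1_def)
    obtain n and f :: "nat \<Rightarrow> real \<times> real set" where f: "bij_betw f {..<n} P1"
      using ex_bij_betw_nat_finite[OF finP1] by (metis atLeast0LessThan)
    define s t where "s i = Inf (snd (f i))" and "t i = Sup (snd (f i))" for i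
    have fi: "f i \<in> P1" if "i < n" for i
      using f that by (auto simp: bij_betw_def)
    have st: "snd (f i) = {s i..t i} \<and> a \<le> s i \<and> s i < t i \<and> t i \<le> b \<and> {s i..t i} \<subseteq> U" if i: "i < n" for i
    proof -
      obtain x K where xK: "f i = (x, K)" by fastforce
      with fi[OF i] have *: "(x, K) \<in> P" "x \<in> N'" "Inf K < Sup K" by (auto simp: P1_def)
      have "K \<subseteq> \<gamma> x" using P(2) *(1) by (auto simp: fine_def)
      then have "K \<subseteq> U" using *(2) by (simp add: \<gamma>_def)
      then show ?thesis using PK[OF *(1)] *(3) by (auto simp: s_def t_def xK)
    qed
    have disj: "{s i<..<t i} \<inter> {s j<..<t j} = {}" if "i < n" "j < n" "i \<noteq> j" for i j
    proof -
      have "f i \<noteq> f j" using f that by (auto simp: bij_betw_def inj_on_def)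
      moreover have "(fst (f i), snd (f i)) \<in> P" "(fst (f j), snd (f j)) \<in> P"
        using fi that P1P by auto
      ultimately have "interior (snd (f i)) \<inter> interior (snd (f j)) = {}"
        using tagged_division_ofD(5)[OF P(1)] by (metis prod.collapse)
      then show ?thesis using st that by simp
    qed
    have sum1: "(\<Sum>i<n. \<bar>F (t i) - F (s i)\<bar>) < e"
    proof (rule acd)
      show "a \<le> s i \<and> s i \<le> t i \<and> t i \<le> b" if "i < n" for i
        using st[OF that] by auto
      show "t i \<le> s j \<or> t j \<le> s i" if ij: "i < n" "j < n" "i \<noteq> j" for i j
      proof (rule ccontr)
        assume "\<not> ?thesis"
        moreover have "s i < t i" "s j < t j" using st ij by auto
        ultimately have "max (s i) (s j) < min (t i) (t j)" by auto
        then obtain y where "max (s i) (s j) < y" "y < min (t i) (t j)" using dense by blast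
        then have "y \<in> {s i<..<t i} \<inter> {s j<..<t j}" by auto
        with disj[OF ij] show False by blast
      qed
      have "(\<Sum>i<n. t i - s i) = (\<Sum>i<n. measure lebesgue {s i<..<t i})"
      proof (rule sum.cong)
        show "t i - s i = measure lebesgue {s i<..<t i}" if "i \<in> {..<n}" for i
          using st[of i] that by simp
      qed simp
      also have "\<dots> = measure lebesgue (\<Union>i<n. {s i<..<t i})"
      proof (rule measure_finite_Union[symmetric])
        show "emeasure lebesgue {s i<..<t i} \<noteq> \<infinity>" if "i \<in> {..<n}" for i
          using st[of i] that by simp
        show "disjoint_family_on (\<lambda>i. {s i<..<t i}) {..<n}"
          using disj by (simp add: disjoint_family_on_def)
      qed auto
      also have "\<dots> \<le> measure lebesgue U"
      proof (rule measure_mono_fmeasurable)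
        have "{s i<..<t i} \<subseteq> U" if "i < n" for i
          using st[OF that] greaterThanLessThan_subseteq_atLeastAtMost_iff by blast
        then show "(\<Union>i<n. {s i<..<t i}) \<subseteq> U" by blast
      qed (use Um in auto)
      finally show "(\<Sum>i<n. t i - s i) < d" using Ud by simp
    qed
    define G where "G z = F (Sup (snd z)) - F (Inf (snd z))" for z :: "real \<times> real set"
    have "F b - F a = sum G P"
      using additive_tagged_division_1[OF \<open>a \<le> b\<close> P(1), of F] by (simp add: G_def case_prod_unfold)
    also have "\<dots> = sum G P1 + sum G (P - P1)"
      using finP P1P by (metis add.commute sum.subset_diff)
    finally have split: "F b - F a = sum G P1 + sum G (P - P1)" .
    have "\<bar>sum G P1\<bar> \<le> (\<Sum>z\<in>P1. \<bar>G z\<bar>)" by (rule sum_abs)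
    also have "\<dots> = (\<Sum>i<n. \<bar>G (f i)\<bar>)"
      using sum.reindex_bij_betw[OF f, of "\<lambda>z. \<bar>G z\<bar>"] by simp
    also have "\<dots> < e" using sum1 by (simp add: G_def s_def t_def)
    finally have part1: "\<bar>sum G P1\<bar> < e" .
    have "\<bar>G z\<bar> \<le> e * (Sup (snd z) - Inf (snd z))" if z: "z \<in> P - P1" for z
    proof -
      obtain x K where xK: "z = (x, K)" by fastforce
      then have xP: "(x, K) \<in> P" using z by auto
      from PK[OF xP] obtain u v where uv: "K = {u..v}" "u \<le> x" "x \<le> v" "a \<le> u" "v \<le> b" by blast
      then have SI: "Sup K = v" "Inf K = u" by auto
      show ?thesis
      proof (cases "u = v")
        case True
        then show ?thesis by (simp add: G_def xK SI)
      next
        case False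
        then have "x \<notin> N'" using z uv by (auto simp: P1_def xK SI)
        then have xin: "x \<in> {a<..<b} - N" using uv by (auto simp: N'_def)
        have "K \<subseteq> \<gamma> x" using P(2) xP by (auto simp: fine_def)
        then have "K \<subseteq> ball x (r x)" using \<open>x \<notin> N'\<close> xin by (simp add: \<gamma>_def split: if_splits)
        moreover have "u \<in> K" "v \<in> K" using uv by auto
        ultimately have "\<bar>u - x\<bar> < r x" "\<bar>v - x\<bar> < r x" by (auto simp: dist_real_def subset_iff)
        then have "\<bar>F u - F x\<bar> \<le> e * (x - u)" "\<bar>F v - F x\<bar> \<le> e * (v - x)"
          using r(2)[OF xin, of u] r(2)[OF xin, of v] uv by auto
        then have "\<bar>F v - F u\<bar> \<le> e * (v - u)" by (simp add: algebra_simps abs_le_iff)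
        then show ?thesis by (simp add: G_def xK SI)
      qed
    qed
    then have "\<bar>sum G (P - P1)\<bar> \<le> (\<Sum>z\<in>P - P1. e * (Sup (snd z) - Inf (snd z)))"
      using sum_norm_le[of "P - P1" G] by simp
    also have "\<dots> \<le> (\<Sum>z\<in>P. e * (Sup (snd z) - Inf (snd z)))"
    proof (rule sum_mono2[OF finP])
      show "0 \<le> e * (Sup (snd z) - Inf (snd z))" if "z \<in> P - (P - P1)" for z
        using that e by (auto simp: P1_def)
    qed auto
    also have "\<dots> = e * (\<Sum>z\<in>P. Sup (snd z) - Inf (snd z))"
      by (simp add: sum_distrib_left)
    also have "\<dots> = e * (b - a)"
      using additive_tagged_division_1[OF \<open>a \<le> b\<close> P(1), of "\<lambda>x. x"] by (simp add: case_prod_unfold)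
    finally show ?thesis using split part1 by (simp add: algebra_simps)
  qed
  show ?thesis
  proof (rule ccontr)
    assume "F b \<noteq> F a"
    define c where "c = \<bar>F b - F a\<bar>"
    have "c > 0" using \<open>F b \<noteq> F a\<close> by (simp add: c_def)
    have "c \<le> c / (2 * (b - a + 1)) * (b - a + 1)"
      using bound[of "c / (2 * (b - a + 1))"] \<open>c > 0\<close> \<open>a \<le> b\<close> by (simp add: c_def)
    also have "\<dots> = c / 2" using \<open>a \<le> b\<close> by (simp add: field_simps)
    finally show False using \<open>c > 0\<close> by simp
  qed
qed

lemma abs_continuous_on_subset:
  assumes "abs_continuous_on a b f" "a \<le> c" "d \<le> b"
  shows "abs_continuous_on c d f"
proof (rule abs_continuous_onI)
  fix e :: real assume "e > 0"
  obtain r where "r > 0" and r: "\<And>(n::nat) s t.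
        \<lbrakk>\<And>i. i < n \<Longrightarrow> a \<le> s i \<and> s i \<le> t i \<and> t i \<le> b;
        \<And>i j. \<lbrakk>i < n; j < n; i \<noteq> j\<rbrakk> \<Longrightarrow> t i \<le> s j \<or> t j \<le> s i;
        (\<Sum>i<n. t i - s i) < r\<rbrakk> \<Longrightarrow> (\<Sum>i<n. \<bar>f (t i) - f (s i)\<bar>) < e"
    using abs_continuous_onE[OF assms(1) \<open>e > 0\<close>] by blast
  show "\<exists>r>0. \<forall>(n::nat) s t.
        (\<forall>i<n. c \<le> s i \<and> s i \<le> t i \<and> t i \<le> d) \<longrightarrow>
        (\<forall>i<n. \<forall>j<n. i \<noteq> j \<longrightarrow> t i \<le> s j \<or> t j \<le> s i) \<longrightarrow>
        (\<Sum>i<n. t i - s i) < r \<longrightarrow> (\<Sum>i<n. \<bar>f (t i) - f (s i)\<bar>) < e"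
  proof (intro exI[of _ r] conjI allI impI)
    fix n :: nat and s t :: "nat \<Rightarrow> real"
    assume H: "\<forall>i<n. c \<le> s i \<and> s i \<le> t i \<and> t i \<le> d"
      "\<forall>i<n. \<forall>j<n. i \<noteq> j \<longrightarrow> t i \<le> s j \<or> t j \<le> s i" "(\<Sum>i<n. t i - s i) < r"
    show "(\<Sum>i<n. \<bar>f (t i) - f (s i)\<bar>) < e"
    proof (rule r)
      show "a \<le> s i \<and> s i \<le> t i \<and> t i \<le> b" if "i < n" for i
        using H(1) that assms(2,3) by force
    qed (use H in auto)
  qed (fact \<open>r > 0\<close>)
qed

lemma lipschitz_on_imp_abs_continuous_on:
  assumes "L-lipschitz_on {a..b} f"
  shows "abs_continuous_on a b f"
proof (rule abs_continuous_onI)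
  fix e :: real assume e: "e > 0"
  have L: "L \<ge> 0" using assms by (rule lipschitz_on_nonneg)
  show "\<exists>d>0. \<forall>(n::nat) s t.
        (\<forall>i<n. a \<le> s i \<and> s i \<le> t i \<and> t i \<le> b) \<longrightarrow>
        (\<forall>i<n. \<forall>j<n. i \<noteq> j \<longrightarrow> t i \<le> s j \<or> t j \<le> s i) \<longrightarrow>
        (\<Sum>i<n. t i - s i) < d \<longrightarrow> (\<Sum>i<n. \<bar>f (t i) - f (s i)\<bar>) < e"
  proof (intro exI[of _ "e / (L + 1)"] conjI allI impI)
    show "e / (L + 1) > 0" using e L by simp
    fix n :: nat and s t :: "nat \<Rightarrow> real"
    assume H: "\<forall>i<n. a \<le> s i \<and> s i \<le> t i \<and> t i \<le> b"
      "\<forall>i<n. \<forall>j<n. i \<noteq> j \<longrightarrow> t i \<le> s j \<or> t j \<le> s i" "(\<Sum>i<n. t i - s i) < e / (L + 1)"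
    have "(\<Sum>i<n. \<bar>f (t i) - f (s i)\<bar>) \<le> (\<Sum>i<n. L * (t i - s i))"
    proof (rule sum_mono)
      fix i assume "i \<in> {..<n}"
      then have "a \<le> s i" "s i \<le> t i" "t i \<le> b" using H(1) by auto
      then show "\<bar>f (t i) - f (s i)\<bar> \<le> L * (t i - s i)"
        using lipschitz_onD[OF assms, of "t i" "s i"] by (simp add: dist_real_def)
    qed
    also have "\<dots> = L * (\<Sum>i<n. t i - s i)" by (simp add: sum_distrib_left)
    also have "\<dots> \<le> L * (e / (L + 1))" using H(3) L by (intro mult_left_mono) auto
    also have "\<dots> < e" using e L by (simp add: field_simps)
    finally show "(\<Sum>i<n. \<bar>f (t i) - f (s i)\<bar>) < e" .
  qed
qed

lemma abs_continuous_on_diff: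
  assumes "abs_continuous_on a b f" "abs_continuous_on a b g"
  shows "abs_continuous_on a b (\<lambda>x. f x - g x)"
proof (rule abs_continuous_onI)
  fix e :: real assume "e > 0"
  then have e: "e / 2 > 0" by simp
  obtain d1 where "d1 > 0" and d1: "\<And>(n::nat) s t.
        \<lbrakk>\<And>i. i < n \<Longrightarrow> a \<le> s i \<and> s i \<le> t i \<and> t i \<le> b;
        \<And>i j. \<lbrakk>i < n; j < n; i \<noteq> j\<rbrakk> \<Longrightarrow> t i \<le> s j \<or> t j \<le> s i;
        (\<Sum>i<n. t i - s i) < d1\<rbrakk> \<Longrightarrow> (\<Sum>i<n. \<bar>f (t i) - f (s i)\<bar>) < e / 2"
    using abs_continuous_onE[OF assms(1) e] by blast
  obtain d2 where "d2 > 0" and d2: "\<And>(n::nat) s t.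
        \<lbrakk>\<And>i. i < n \<Longrightarrow> a \<le> s i \<and> s i \<le> t i \<and> t i \<le> b;
        \<And>i j. \<lbrakk>i < n; j < n; i \<noteq> j\<rbrakk> \<Longrightarrow> t i \<le> s j \<or> t j \<le> s i;
        (\<Sum>i<n. t i - s i) < d2\<rbrakk> \<Longrightarrow> (\<Sum>i<n. \<bar>g (t i) - g (s i)\<bar>) < e / 2"
    using abs_continuous_onE[OF assms(2) e] by blast
  show "\<exists>d>0. \<forall>(n::nat) s t.
        (\<forall>i<n. a \<le> s i \<and> s i \<le> t i \<and> t i \<le> b) \<longrightarrow>
        (\<forall>i<n. \<forall>j<n. i \<noteq> j \<longrightarrow> t i \<le> s j \<or> t j \<le> s i) \<longrightarrow>
        (\<Sum>i<n. t i - s i) < d \<longrightarrow> (\<Sum>i<n. \<bar>f (t i) - g (t i) - (f (s i) - g (s i))\<bar>) < e"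
  proof (intro exI[of _ "min d1 d2"] conjI allI impI)
    show "min d1 d2 > 0" using \<open>d1 > 0\<close> \<open>d2 > 0\<close> by simp
    fix n :: nat and s t :: "nat \<Rightarrow> real"
    assume H: "\<forall>i<n. a \<le> s i \<and> s i \<le> t i \<and> t i \<le> b"
      "\<forall>i<n. \<forall>j<n. i \<noteq> j \<longrightarrow> t i \<le> s j \<or> t j \<le> s i" "(\<Sum>i<n. t i - s i) < min d1 d2"
    have "(\<Sum>i<n. \<bar>f (t i) - f (s i)\<bar>) < e / 2" "(\<Sum>i<n. \<bar>g (t i) - g (s i)\<bar>) < e / 2"
      using H by (intro d1 d2; simp)+
    moreover have "(\<Sum>i<n. \<bar>f (t i) - g (t i) - (f (s i) - g (s i))\<bar>)
        \<le> (\<Sum>i<n. \<bar>f (t i) - f (s i)\<bar> + \<bar>g (t i) - g (s i)\<bar>)"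
      by (intro sum_mono) linarith
    moreover have "\<dots> = (\<Sum>i<n. \<bar>f (t i) - f (s i)\<bar>) + (\<Sum>i<n. \<bar>g (t i) - g (s i)\<bar>)"
      by (rule sum.distrib)
    ultimately show "(\<Sum>i<n. \<bar>f (t i) - g (t i) - (f (s i) - g (s i))\<bar>) < e" by linarith
  qed
qed

lemma real_derivative_bounded_imp_lipschitz_on:
  fixes f :: "real \<Rightarrow> real"
  assumes "\<And>x. x \<in> {a..b} \<Longrightarrow> (f has_real_derivative f' x) (at x within {a..b})"
    and "\<And>x. x \<in> {a..b} \<Longrightarrow> \<bar>f' x\<bar> \<le> C" and "C \<ge> 0"
  shows "C-lipschitz_on {a..b} f"
  using field_differentiable_bound[of "{a..b}" f f' C] assms
  by (intro lipschitz_onI) (auto simp: dist_real_def)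

text \<open>After subtracting the indefinite integral \<open>G\<close> of \<open>g\<close>, an
  absolutely continuous function with zero derivative almost everywhere remains, and that is
  constant. This turns the almost-everywhere equation into a classical one, up to the ends, on each
  interval where \<open>a_h\<close> is constant.\<close>

lemma abs_continuous_on_imp_deriv:
  fixes F g :: "real \<Rightarrow> real"
  assumes ac: "abs_continuous_on a b F" and g: "continuous_on {a..b} g"
    and ae: "AE x in lebesgue. x \<in> {a<..<b} \<longrightarrow> (F has_real_derivative g x) (at x)"
    and x: "x \<in> {a..b}"
  shows "(F has_real_derivative g x) (at x within {a..b})"
proof -
  define G where "G x = integral {a..x} g" for x
  have G: "(G has_real_derivative g y) (at y within {a..b})" if "y \<in> {a..b}" for y
    unfolding G_def by (rule integral_has_real_derivative[OF g that])
  have "bounded (g ` {a..b})"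
    by (intro compact_imp_bounded compact_continuous_image[OF g]) simp
  then obtain C where "\<forall>z\<in>g ` {a..b}. norm z \<le> C" unfolding bounded_iff by blast
  then have C: "\<bar>g y\<bar> \<le> C" if "y \<in> {a..b}" for y using that by simp
  have "\<bar>C\<bar>-lipschitz_on {a..b} G"
    using G by (rule real_derivative_bounded_imp_lipschitz_on) (use C in force)+
  then have ac': "abs_continuous_on a b (\<lambda>y. F y - G y)"
    by (intro abs_continuous_on_diff ac lipschitz_on_imp_abs_continuous_on)
  obtain N where N: "\<And>y. y \<in> space lebesgue - N \<Longrightarrow> y \<in> {a<..<b} \<longrightarrow> (F has_real_derivative g y) (at y)"
    and N0: "N \<in> null_sets lebesgue"
    using AE_E3[OF ae] by blast
  have const: "F y - G y = F a - G a" if y: "y \<in> {a..b}" for y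
  proof (rule abs_continuous_on_deriv_zero[where F = "\<lambda>y. F y - G y"])
    show "negligible N" using N0 by (simp add: negligible_iff_null_sets)
    show "abs_continuous_on a y (\<lambda>y. F y - G y)"
      using ac' by (rule abs_continuous_on_subset) (use y in auto)
    show "((\<lambda>y. F y - G y) has_real_derivative 0) (at z)" if z: "z \<in> {a<..<y} - N" for z
    proof -
      have zab: "z \<in> {a<..<b}" using z y by auto
      then have "(G has_real_derivative g z) (at z)"
        using G[of z] at_within_interior[of z "{a..b}"] by auto
      then show ?thesis
        using N[of z] z zab by (auto intro!: derivative_eq_intros)
    qed
  qed (use y in auto)
  have eq: "F y = G y + (F a - G a)" if "y \<in> {a..b}" for y
    using const[OF that] by linarith
  have "((\<lambda>y. G y + (F a - G a)) has_real_derivative g x) (at x within {a..b})"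
    using G[OF x] by (auto intro!: derivative_eq_intros)
  then show ?thesis
    by (rule has_field_derivative_transform_within[OF _ zero_less_one x]) (rule eq[symmetric])
qed

subsection \<open>Travel times\<close>

lemma has_real_derivative_within_imp_increasing:
  fixes f :: "real \<Rightarrow> real"
  assumes "a < b" and der: "\<And>x. x \<in> {a..b} \<Longrightarrow> (f has_real_derivative f' x) (at x within {a..b})"
    and pos: "\<And>x. x \<in> {a<..<b} \<Longrightarrow> f' x > 0"
  shows "f a < f b"
proof (rule DERIV_pos_imp_increasing_open[OF \<open>a < b\<close>])
  show "continuous_on {a..b} f" using der by (rule DERIV_continuous_on)
  show "\<exists>y. (f has_real_derivative y) (at x) \<and> y > 0" if "a < x" "x < b" for x
    using der[of x] pos[of x] at_within_interior[of x "{a..b}"] that by auto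
qed

lemma has_real_derivative_within_zero_imp_const:
  fixes f :: "real \<Rightarrow> real"
  assumes "\<And>x. x \<in> {a..b} \<Longrightarrow> (f has_real_derivative 0) (at x within {a..b})"
    and "x \<in> {a..b}" "y \<in> {a..b}"
  shows "f x = f y"
proof -
  obtain c where "\<forall>x\<in>{a..b}. f x = c"
    using has_field_derivative_zero_constant[of "{a..b}" f] assms(1) by auto
  then show ?thesis using assms by metis
qed

text \<open>The difference quotient of \<open>\<phi>\<close> is the reciprocal of that of
  \<open>T\<close>, evaluated along \<open>\<phi>\<close>; continuity and injectivity of
  \<open>\<phi>\<close> allow the limit to be composed. Working relative to sets covers the
  endpoints of the outer interval.\<close>

lemma has_real_derivative_inverse_within:
  fixes T \<phi> :: "real \<Rightarrow> real"
  assumes T: "(T has_real_derivative g) (at (\<phi> x) within A)" and g: "g \<noteq> 0"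
    and cont: "continuous (at x within B) \<phi>" and x: "x \<in> B"
    and inv: "\<And>y. y \<in> B \<Longrightarrow> \<phi> y \<in> A \<and> T (\<phi> y) = y"
  shows "(\<phi> has_real_derivative inverse g) (at x within B)"
proof -
  have ne: "\<phi> y \<noteq> \<phi> x" if "y \<in> B" "y \<noteq> x" for y
    using inv[OF that(1)] inv[OF x] that(2) by metis
  have "eventually (\<lambda>y. \<phi> y \<in> A \<and> \<phi> y \<noteq> \<phi> x) (at x within B)"
    using ne inv by (auto simp: eventually_at_filter)
  then have "filterlim \<phi> (at (\<phi> x) within A) (at x within B)"
    using cont by (auto simp: filterlim_at continuous_within elim: eventually_mono)
  moreover have "((\<lambda>w. inverse ((T w - T (\<phi> x)) / (w - \<phi> x))) \<longlongrightarrow> inverse g) (at (\<phi> x) within A)"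
    using T g by (intro tendsto_inverse) (auto simp: has_field_derivative_iff)
  ultimately have "((\<lambda>y. inverse ((T (\<phi> y) - T (\<phi> x)) / (\<phi> y - \<phi> x))) \<longlongrightarrow> inverse g) (at x within B)"
    by (rule filterlim_compose[rotated])
  moreover have "eventually (\<lambda>y. inverse ((T (\<phi> y) - T (\<phi> x)) / (\<phi> y - \<phi> x)) = (\<phi> y - \<phi> x) / (y - x)) (at x within B)"
    using inv x by (auto simp: eventually_at_filter)
  ultimately show ?thesis
    unfolding has_field_derivative_iff by (rule Lim_transform_eventually)
qed

text \<open>The delicate point is \<open>x = 0\<close>, where the difference quotient equals
  \<open>x powr (a - 1)\<close> and tends to 0 because \<open>a > 1\<close>. It is needed since
  solutions start from height 0.\<close>

lemma has_real_derivative_powr_nonneg: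
  fixes x a :: real
  assumes "a > 1" "x \<ge> 0"
  shows "((\<lambda>x. x powr a) has_real_derivative a * x powr (a - 1)) (at x within {0..})"
proof (cases "x = 0")
  case True
  have "continuous_on {0..} (\<lambda>y::real. y powr (a - 1))"
    using assms by (intro continuous_on_powr' continuous_intros) auto
  then have "((\<lambda>y::real. y powr (a - 1)) \<longlongrightarrow> 0) (at 0 within {0..})"
    by (force simp: continuous_on_def)
  moreover have "eventually (\<lambda>y. y powr (a - 1) = (y powr a - 0 powr a) / (y - 0)) (at 0 within {0::real..})"
    by (auto simp: eventually_at_filter powr_diff)
  ultimately show ?thesis
    using True by (auto simp: has_field_derivative_iff elim: Lim_transform_eventually)
next
  case False
  then show ?thesis
    using assms by (intro has_field_derivative_at_within[OF has_real_derivative_powr]) auto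
qed

section \<open>Slope and travel time as functions of the height\<close>

text \<open>Conservation of energy for \<open>z'' = - l z - (p + 1)/2 M z\<^sup>p\<close> expresses the squared slope
  \<open>z'\<^sup>2\<close> at height \<open>w\<close>, normalised by \<open>z'\<^sup>2 = l (1 - k\<^sup>2)\<close> at height \<open>k\<close>.\<close>
definition slope_sq :: "real \<Rightarrow> real \<Rightarrow> real \<Rightarrow> real \<Rightarrow> real \<Rightarrow> real" where
  "slope_sq p l M k w = l * (1 - w\<^sup>2) + M * (k powr (p + 1) - w powr (p + 1))"

definition travel_time :: "real \<Rightarrow> real \<Rightarrow> real \<Rightarrow> real \<Rightarrow> real \<Rightarrow> real" where
  "travel_time p l M k z = integral {0..z} (\<lambda>w. 1 / sqrt (slope_sq p l M k w))"

lemma slope_sq_deriv: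
  assumes "p > 1" "w \<in> {0..k}"
  shows "(slope_sq p l M k has_real_derivative - 2 * l * w - M * (p + 1) * w powr p) (at w within {0..k})"
proof -
  have "((\<lambda>x. x powr (p + 1)) has_real_derivative (p + 1) * w powr (p + 1 - 1)) (at w within {0..k})"
    by (rule has_field_derivative_subset[OF has_real_derivative_powr_nonneg]) (use assms in auto)
  then have "((\<lambda>x. x powr (p + 1)) has_real_derivative (p + 1) * w powr p) (at w within {0..k})"
    by simp
  then have "((\<lambda>x. l * (1 - x\<^sup>2) + M * (k powr (p + 1) - x powr (p + 1))) has_real_derivative
      l * (0 - 2 * w) + M * (0 - (p + 1) * w powr p)) (at w within {0..k})"
    by (intro DERIV_add DERIV_cmult DERIV_diff DERIV_const) (auto intro!: derivative_eq_intros)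
  moreover have "l * (0 - 2 * w) + M * (0 - (p + 1) * w powr p) = - 2 * l * w - M * (p + 1) * w powr p"
    by simp
  ultimately show ?thesis
    unfolding slope_sq_def [abs_def] by metis
qed

text \<open>The lower bound is the squared slope of the linear motion \<open>M = 0\<close>, a cosine
  arc; below height \<open>k\<close> the nonlinear term can only add to it.\<close>

lemma slope_sq_ge:
  assumes "p > 1" "l \<ge> 0" "M \<ge> 0" "0 \<le> w" "w \<le> k"
  shows "slope_sq p l M k w \<ge> l * (1 - w\<^sup>2)"
  using assms by (auto simp: slope_sq_def intro!: mult_nonneg_nonneg powr_mono2)

lemma slope_sq_gt:
  assumes "p > 1" "M > 0" "0 \<le> w" "w < k"
  shows "slope_sq p l M k w > l * (1 - w\<^sup>2)"
  using assms by (auto simp: slope_sq_def intro!: mult_pos_pos powr_less_mono2)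

lemma slope_sq_pos:
  assumes "p > 1" "l > 0" "M \<ge> 0" "0 \<le> w" "w \<le> k" "k < 1"
  shows "slope_sq p l M k w > 0"
proof -
  have "w\<^sup>2 < 1" using assms by (simp add: power_less_one_iff)
  then have "0 < l * (1 - w\<^sup>2)" using assms by simp
  then show ?thesis using slope_sq_ge[of p l M w k] assms by linarith
qed

lemma continuous_on_slope_sq: "p > 1 \<Longrightarrow> continuous_on {0..k} (slope_sq p l M k)"
  using slope_sq_deriv by (rule DERIV_continuous_on)

context
  fixes p l M k :: real
  assumes p: "p > 1" and l: "l > 0" and M: "M \<ge> 0" and k: "0 < k" "k < 1"
begin

lemma travel_time_deriv:
  assumes "z \<in> {0..k}"
  shows "(travel_time p l M k has_real_derivative 1 / sqrt (slope_sq p l M k z)) (at z within {0..k})"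
  unfolding travel_time_def [abs_def]
proof (rule integral_has_real_derivative[OF _ assms])
  show "continuous_on {0..k} (\<lambda>w. 1 / sqrt (slope_sq p l M k w))"
    using slope_sq_pos[OF p l M _ _ k(2)]
    by (intro continuous_intros continuous_on_slope_sq p) (force simp: less_le)
qed

lemma travel_time_strict_mono:
  assumes "0 \<le> x" "x < y" "y \<le> k"
  shows "travel_time p l M k x < travel_time p l M k y"
proof (rule has_real_derivative_within_imp_increasing[OF \<open>x < y\<close>])
  show "(travel_time p l M k has_real_derivative 1 / sqrt (slope_sq p l M k z)) (at z within {x..y})"
    if "z \<in> {x..y}" for z
    by (rule has_field_derivative_subset[OF travel_time_deriv]) (use assms that in auto)
  show "1 / sqrt (slope_sq p l M k z) > 0" if "z \<in> {x<..<y}" for z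
    using slope_sq_pos[OF p l M, of z k] assms that k by simp
qed

lemma travel_time_0 [simp]: "travel_time p l M k 0 = 0"
  by (simp add: travel_time_def)

lemma travel_time_inj:
  assumes "travel_time p l M k x = travel_time p l M k y" "x \<in> {0..k}" "y \<in> {0..k}"
  shows "x = y"
proof (cases x y rule: linorder_cases)
  case less
  then show ?thesis using travel_time_strict_mono[of x y] assms by simp
next
  case greater
  then show ?thesis using travel_time_strict_mono[of y x] assms by simp
qed

text \<open>The inverse of the travel time solves the first-order equation on the outer interval.
  Since \<open>k < 1\<close>, the slope stays positive on \<open>{0..k}\<close>, so the travel time
  is strictly increasing with nonzero derivative and its inverse is differentiable up to both
  ends.\<close>

lemma travel_time_inverse:
  defines "X \<equiv> travel_time p l M k k"
  obtains \<phi> where "\<phi> 0 = 0" "\<phi> X = k"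
    and "\<And>x. x \<in> {0..X} \<Longrightarrow> \<phi> x \<in> {0..k} \<and> travel_time p l M k (\<phi> x) = x"
    and "\<And>x. x \<in> {0..X} \<Longrightarrow> (\<phi> has_real_derivative sqrt (slope_sq p l M k (\<phi> x))) (at x within {0..X})"
proof -
  let ?T = "travel_time p l M k"
  define \<phi> where "\<phi> = inv_into {0..k} ?T"
  have contT: "continuous_on {0..k} ?T"
    using travel_time_deriv by (rule DERIV_continuous_on)
  have inj: "inj_on ?T {0..k}"
    by (rule inj_onI, rule travel_time_inj)
  have img: "?T ` {0..k} = {0..X}"
  proof
    have "0 \<le> ?T w \<and> ?T w \<le> X" if "w \<in> {0..k}" for w
      using travel_time_strict_mono[of 0 w] travel_time_strict_mono[of w k] that k
      by (cases "w = 0"; cases "w = k") (simp_all add: X_def)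
    then show "?T ` {0..k} \<subseteq> {0..X}" by auto
    show "{0..X} \<subseteq> ?T ` {0..k}"
    proof
      fix x assume "x \<in> {0..X}"
      then obtain w where "0 \<le> w" "w \<le> k" "?T w = x"
        using IVT'[of ?T 0 x k] contT k by (auto simp: X_def)
      then show "x \<in> ?T ` {0..k}" by auto
    qed
  qed
  have inv: "\<phi> x \<in> {0..k} \<and> ?T (\<phi> x) = x" if "x \<in> {0..X}" for x
    using that img f_inv_into_f[of x ?T "{0..k}"] inv_into_into[of x ?T "{0..k}"]
    by (simp add: \<phi>_def)
  have inv': "\<phi> (?T w) = w" if "w \<in> {0..k}" for w
    using inj that by (simp add: \<phi>_def)
  have cont: "continuous_on {0..X} \<phi>"
    using continuous_on_inv[OF contT, of \<phi>] inv' img by simp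
  show thesis
  proof (rule that)
    show "\<phi> 0 = 0" using inv'[of 0] k by simp
    show "\<phi> X = k" using inv'[of k] k by (simp add: X_def)
    show "\<phi> x \<in> {0..k} \<and> ?T (\<phi> x) = x" if "x \<in> {0..X}" for x using inv[OF that] .
    show "(\<phi> has_real_derivative sqrt (slope_sq p l M k (\<phi> x))) (at x within {0..X})" if x: "x \<in> {0..X}" for x
    proof -
      have "slope_sq p l M k (\<phi> x) > 0"
        using slope_sq_pos[OF p l M, of "\<phi> x" k] inv[OF x] k by simp
      then have "(\<phi> has_real_derivative inverse (1 / sqrt (slope_sq p l M k (\<phi> x)))) (at x within {0..X})"
      proof (intro has_real_derivative_inverse_within[where A = "{0..k}"])
        show "(?T has_real_derivative 1 / sqrt (slope_sq p l M k (\<phi> x))) (at (\<phi> x) within {0..k})"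
          using inv[OF x] by (intro travel_time_deriv) blast
        show "continuous (at x within {0..X}) \<phi>"
          using cont x by (simp add: continuous_on_eq_continuous_within)
      qed (use x inv in auto)
      then show ?thesis by (simp add: inverse_eq_divide)
    qed
  qed
qed

end

text \<open>The right-hand side is the travel time of the linear motion \<open>M = 0\<close>. For
  \<open>M > 0\<close> the slope is strictly larger below \<open>k\<close>, so the difference of the
  two times increases strictly from 0.\<close>

lemma travel_time_less_arcsin:
  assumes "p > 1" "l > 0" "M > 0" "0 < k" "k < 1"
  shows "travel_time p l M k k < arcsin k / sqrt l"
proof -
  let ?D = "\<lambda>w. arcsin w / sqrt l - travel_time p l M k w"
  have "?D 0 < ?D k"
  proof (rule has_real_derivative_within_imp_increasing[OF \<open>0 < k\<close>])
    fix w assume w: "w \<in> {0..k}"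
    have "(arcsin has_real_derivative inverse (sqrt (1 - w\<^sup>2))) (at w within {0..k})"
      by (intro has_field_derivative_at_within[OF DERIV_arcsin]) (use w assms in auto)
    moreover have "(travel_time p l M k has_real_derivative 1 / sqrt (slope_sq p l M k w)) (at w within {0..k})"
      using assms w by (intro travel_time_deriv) auto
    ultimately show "(?D has_real_derivative
        inverse (sqrt (1 - w\<^sup>2)) / sqrt l - 1 / sqrt (slope_sq p l M k w)) (at w within {0..k})"
      by (intro DERIV_diff DERIV_cdivide)
  next
    fix w assume w: "w \<in> {0<..<k}"
    then have "w\<^sup>2 < 1" using assms by (simp add: power_less_one_iff)
    then have "0 < sqrt (l * (1 - w\<^sup>2))" using assms by simp
    moreover have "sqrt (l * (1 - w\<^sup>2)) < sqrt (slope_sq p l M k w)"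
      using slope_sq_gt[of p M w k l] w assms by simp
    ultimately have "1 / sqrt (slope_sq p l M k w) < 1 / sqrt (l * (1 - w\<^sup>2))"
      by (intro divide_strict_left_mono) auto
    then show "0 < inverse (sqrt (1 - w\<^sup>2)) / sqrt l - 1 / sqrt (slope_sq p l M k w)"
      by (simp only: real_sqrt_mult inverse_eq_divide) (simp add: mult.commute)
  qed
  then show ?thesis by (simp add: travel_time_def)
qed

section \<open>Tuning \<open>l\<close> for a prescribed amplitude\<close>

lemma continuous_on_travel_time_parameter:
  assumes "p > 1" "L > 0" "M \<ge> 0" "0 < k" "k < 1"
  shows "continuous_on {L..} (\<lambda>l. travel_time p l M k k)"
proof -
  have "continuous_on ({L..} \<times> cbox 0 k) (\<lambda>(l, w). 1 / sqrt (slope_sq p l M k w))"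
    unfolding case_prod_unfold
  proof (intro continuous_intros)
    show "continuous_on ({L..} \<times> cbox 0 k) (\<lambda>x. slope_sq p (fst x) M k (snd x))"
      unfolding slope_sq_def using assms by (intro continuous_intros continuous_on_powr') auto
    show "\<forall>x\<in>{L..} \<times> cbox 0 k. sqrt (slope_sq p (fst x) M k (snd x)) \<noteq> 0"
    proof
      fix x assume "x \<in> {L..} \<times> cbox 0 k"
      then have "slope_sq p (fst x) M k (snd x) > 0"
        using assms by (intro slope_sq_pos) auto
      then show "sqrt (slope_sq p (fst x) M k (snd x)) \<noteq> 0" by simp
    qed
  qed
  then show ?thesis
    using integral_continuous_on_param[of "{L..}" 0 k "\<lambda>l w. 1 / sqrt (slope_sq p l M k w)"]
    by (simp add: travel_time_def)
qed

text \<open>At \<open>l = pi\<^sup>2\<close> the sum is strictly below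
  \<open>(arccos k + arcsin k) / pi = 1 / 2\<close>; at \<open>l = (2 * arccos k)\<^sup>2\<close>
  the first term alone is \<open>1 / 2\<close> and the travel time adds a positive amount. The
  strict inequality at the upper end gives \<open>l < pi\<^sup>2\<close>.\<close>

lemma exists_parameter_half_period:
  assumes "p > 1" "M > 0" "0 < k" "k < 1"
  obtains l where "(2 * arccos k)\<^sup>2 \<le> l" "0 < l" "l < pi\<^sup>2"
    "arccos k / sqrt l + travel_time p l M k k = 1 / 2"
proof -
  let ?L = "(2 * arccos k)\<^sup>2"
  let ?F = "\<lambda>l. arccos k / sqrt l + travel_time p l M k k"
  have ac: "0 < arccos k" "arccos k < pi / 2"
    using arccos_lt_bounded[of k] arccos_less_arccos[of 0 k] assms by auto
  then have L: "?L > 0" "?L < pi\<^sup>2"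
    using power_strict_mono[of "2 * arccos k" pi 2] by auto
  have "travel_time p (pi\<^sup>2) M k k < arcsin k / sqrt (pi\<^sup>2)"
    using assms by (intro travel_time_less_arcsin) auto
  then have pi2: "?F (pi\<^sup>2) < 1 / 2"
    using assms by (simp add: arccos_arcsin_eq field_simps)
  have "travel_time p ?L M k 0 < travel_time p ?L M k k"
    using assms L by (intro travel_time_strict_mono) auto
  moreover have "travel_time p ?L M k 0 = 0" by (simp add: travel_time_def)
  moreover have "sqrt ?L = 2 * arccos k" using ac by (intro real_sqrt_unique) auto
  then have "arccos k / sqrt ?L = 1 / 2" using ac by (simp only:) simp
  ultimately have F1: "1 / 2 \<le> ?F ?L" by linarith
  have "continuous_on {?L..pi\<^sup>2} ?F"
  proof (intro continuous_intros)
    show "continuous_on {?L..pi\<^sup>2} (\<lambda>l. travel_time p l M k k)"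
      by (rule continuous_on_subset[OF continuous_on_travel_time_parameter[of p ?L]])
        (use assms L in auto)
    show "\<forall>l\<in>{?L..pi\<^sup>2}. sqrt l \<noteq> 0" using L by auto
  qed
  then obtain l where l: "?L \<le> l" "l \<le> pi\<^sup>2" "?F l = 1 / 2"
    using IVT2'[of ?F "pi\<^sup>2" "1 / 2" ?L] pi2 F1 L by auto
  then have "l \<noteq> pi\<^sup>2" using pi2 by auto
  moreover have "0 < l" using L(1) l(1) by linarith
  ultimately show thesis using l by (intro that[of l]) auto
qed

subsection \<open>Uniqueness of symmetric positive solutions\<close>

lemma has_real_derivative_powr_comp_nonneg:
  fixes f :: "real \<Rightarrow> real"
  assumes "a > 1" "(f has_real_derivative D) (at x within S)" "\<And>y. y \<in> S \<Longrightarrow> f y \<ge> 0" "x \<in> S"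
  shows "((\<lambda>y. f y powr a) has_real_derivative a * f x powr (a - 1) * D) (at x within S)"
proof -
  have "((\<lambda>y. y powr a) has_real_derivative a * f x powr (a - 1)) (at (f x) within f ` S)"
    by (rule has_field_derivative_subset[OF has_real_derivative_powr_nonneg]) (use assms in auto)
  from DERIV_image_chain[OF this assms(2)] show ?thesis by (simp add: o_def)
qed

text \<open>This puts every solution into the normal form used for comparison. Dividing by the
  midpoint value \<open>b\<close> turns the coefficient of the nonlinear term into
  \<open>b powr (p - 1) = M * (p + 1) / 2\<close>, so the amplitude enters only through
  \<open>M\<close>, whereas the interface height \<open>k\<close> depends on \<open>l\<close> and
  \<open>h\<close> alone.\<close>

lemma sym_pos_solution_profile:
  fixes p l h :: real and v :: "real \<Rightarrow> real"
  assumes p: "p > 1" and l: "0 < l" "l < pi\<^sup>2" and h: "0 < h" "h < 1"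
    and sol: "is_sym_pos_solution p l h v"
  defines "b \<equiv> v (1/2)" and "X \<equiv> (1 - h) / 2" and "k \<equiv> cos (sqrt l * h / 2)"
  defines "M \<equiv> 2 * b powr (p - 1) / (p + 1)"
  shows "b > 0" and "0 < k" and "k < 1"
    and "\<And>x. x \<in> {X..1/2} \<Longrightarrow> v x = b * cos (sqrt l * (1/2 - x))"
    and "\<And>x. x \<in> {0..X} \<Longrightarrow> v x / b \<in> {0..k}"
    and "\<And>x. x \<in> {0..<X} \<Longrightarrow> v x / b < k"
    and "\<And>x. x \<in> {0..X} \<Longrightarrow>
      ((\<lambda>x. v x / b) has_real_derivative sqrt (slope_sq p l M k (v x / b))) (at x within {0..X})"
proof -
  define s where "s = sqrt l"
  have s: "0 < s" "s < pi" "s * s = l"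
    using l real_sqrt_less_mono[of l "pi\<^sup>2"] by (auto simp: s_def)
  have angle: "0 < s * h / 2" "s * h / 2 < pi / 2"
    using s h mult_strict_mono[of s pi h 1] by auto
  have X: "0 < X" "X < 1/2" "1/2 - X = h / 2" using h by (auto simp: X_def field_simps)
  have pos: "v x > 0" if "x \<in> {0<..<1}" for x
    using sol that unfolding is_sym_pos_solution_def by blast
  have sym: "v x = v (1 - x)" if "x \<in> {0..1}" for x
    using sol that unfolding is_sym_pos_solution_def by blast
  have v0: "v 0 = 0" "v 1 = 0"
    using sol unfolding is_sym_pos_solution_def is_solution_def by blast+
  have nonneg: "v x \<ge> 0" if "x \<in> {0..1}" for x
    using pos[of x] v0 that by (cases "x = 0 \<or> x = 1") (auto intro: less_imp_le)
  show b: "b > 0" using pos[of "1/2"] by (simp add: b_def)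
  show k: "0 < k" using angle by (auto simp: k_def s_def intro!: cos_gt_zero_pi)
  show "k < 1" using angle cos_monotone_0_pi[of 0 "s * h / 2"] by (simp add: k_def s_def)
  obtain v' where D: "\<And>x. x \<in> {0..1} \<Longrightarrow> (v has_real_derivative v' x) (at x within {0..1})"
    and cont': "continuous_on {0..1} v'" and ac: "abs_continuous_on 0 1 v'"
    and ae: "AE x in lebesgue. x \<in> {0<..<1} \<longrightarrow>
        (v' has_real_derivative - (l * v x + a_h h x * v x powr p)) (at x)"
    using sol unfolding is_sym_pos_solution_def is_solution_def by blast
  have cont: "continuous_on {0..1} v" using D by (rule DERIV_continuous_on)
  have Dsub: "(v has_real_derivative v' x) (at x within S)" if "x \<in> S" "S \<subseteq> {0..1}" for x S
    by (rule has_field_derivative_subset[OF D]) (use that in auto)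

  \<comment> \<open>The weight is 1 on the outer open interval and 0 between \<open>X\<close> and
    the midpoint, so on each closed piece the right-hand side has a continuous version and the
    equation holds at every point, one-sidedly at \<open>X\<close>.\<close>
  have D2_left: "(v' has_real_derivative - (l * v x + v x powr p)) (at x within {0..X})"
    if x: "x \<in> {0..X}" for x
  proof (rule abs_continuous_on_imp_deriv[OF _ _ _ x])
    show "abs_continuous_on 0 X v'" using ac by (rule abs_continuous_on_subset) (use X in auto)
    have "continuous_on {0..X} v" using cont by (rule continuous_on_subset) (use X in auto)
    then show "continuous_on {0..X} (\<lambda>x. - (l * v x + v x powr p))"
      using nonneg X p by (intro continuous_intros continuous_on_powr') auto
    show "AE x in lebesgue. x \<in> {0<..<X} \<longrightarrow> (v' has_real_derivative - (l * v x + v x powr p)) (at x)"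
      using ae by (rule AE_mp) (use X in \<open>auto simp: a_h_def X_def\<close>)
  qed
  have D2_mid: "(v' has_real_derivative - (l * v x)) (at x within {X..1/2})"
    if x: "x \<in> {X..1/2}" for x
  proof (rule abs_continuous_on_imp_deriv[OF _ _ _ x])
    show "abs_continuous_on X (1/2) v'" using ac by (rule abs_continuous_on_subset) (use X in auto)
    have "continuous_on {X..1/2} v" using cont by (rule continuous_on_subset) (use X in auto)
    then show "continuous_on {X..1/2} (\<lambda>x. - (l * v x))" by (intro continuous_intros)
    show "AE x in lebesgue. x \<in> {X<..<1/2} \<longrightarrow> (v' has_real_derivative - (l * v x)) (at x)"
      using ae by (rule AE_mp) (use X h in \<open>auto simp: a_h_def X_def\<close>)
  qed

  \<comment> \<open>Reflection about the midpoint reverses the sign of the derivative there.\<close>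
  have v'half: "v' (1/2) = 0"
  proof -
    have at: "(v has_real_derivative v' (1/2)) (at (1/2))"
      using D[of "1/2"] at_within_interior[of "1/2" "{0..1::real}"] by simp
    have "((\<lambda>x. v (1 - x)) has_real_derivative v' (1/2) * (-1)) (at (1/2))"
      by (rule DERIV_chain'[of "\<lambda>x. 1 - x"]) (use at in \<open>auto intro!: derivative_eq_intros\<close>)
    then have "(v has_real_derivative v' (1/2) * (-1)) (at (1/2))"
    proof (rule has_field_derivative_transform_within_open)
      show "v (1 - x) = v x" if "x \<in> {0<..<1}" for x
        using sym[of x] that by simp
    qed auto
    from DERIV_unique[OF at this] show ?thesis by linarith
  qed

  \<comment> \<open>\<open>w\<close> is the deviation from the expected cosine arc and solves the
    linear equation with zero data at the midpoint. Its energy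
    \<open>(w' x)\<^sup>2 + l * (w x)\<^sup>2\<close> is constant, hence zero, which forces
    \<open>w\<close> and \<open>w'\<close> to vanish.\<close>
  define w where "w x = v x - b * cos (s * (1/2 - x))" for x
  define w' where "w' x = v' x - b * s * sin (s * (1/2 - x))" for x
  have "w x = 0 \<and> w' x = 0" if x: "x \<in> {X..1/2}" for x
  proof -
    have "(w' x)\<^sup>2 + l * (w x)\<^sup>2 = (w' (1/2))\<^sup>2 + l * (w (1/2))\<^sup>2"
    proof (rule has_real_derivative_within_zero_imp_const[where f = "\<lambda>x. (w' x)\<^sup>2 + l * (w x)\<^sup>2", OF _ x])
      fix y assume y: "y \<in> {X..1/2}"
      have "(w has_real_derivative w' y) (at y within {X..1/2})"
        unfolding w_def [abs_def] w'_def
        using X y by (auto intro!: derivative_eq_intros Dsub)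
      moreover have "(w' has_real_derivative - l * w y) (at y within {X..1/2})"
        unfolding w_def w'_def [abs_def] using s(3)
        by (auto intro!: derivative_eq_intros D2_mid[OF y] simp: algebra_simps)
      ultimately show "((\<lambda>x. (w' x)\<^sup>2 + l * (w x)\<^sup>2) has_real_derivative 0) (at y within {X..1/2})"
        by (auto intro!: derivative_eq_intros)
    qed (use X in auto)
    also have "\<dots> = 0" by (simp add: w_def w'_def v'half b_def)
    finally show ?thesis
      using l mult_nonneg_nonneg[of l "(w x)\<^sup>2"] zero_le_power2[of "w' x"]
      by (auto simp: add_nonneg_eq_0_iff)
  qed
  then have mid: "v x = b * cos (s * (1/2 - x))" "v' x = b * s * sin (s * (1/2 - x))"
    if "x \<in> {X..1/2}" for x
    using that unfolding w_def w'_def by (metis eq_iff_diff_eq_0)+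
  then show "v x = b * cos (sqrt l * (1/2 - x))" if "x \<in> {X..1/2}" for x
    using that by (simp add: s_def)
  have vX: "v X = b * k" "v' X = b * s * sin (s * h / 2)"
    using mid[of X] X by (auto simp: k_def s_def)
  have v'X: "v' X > 0" using vX b s angle by (auto intro!: mult_pos_pos sin_gt_zero)

  \<comment> \<open>On the outer interval \<open>v\<close> is concave, so \<open>v'\<close> is at
    least its positive value at \<open>X\<close>. The sign later selects the positive square root in
    the energy identity.\<close>
  have v'pos: "v' x > 0" if x: "x \<in> {0..X}" for x
  proof (cases "x = X")
    case False
    have "- v' x < - v' X"
    proof (rule has_real_derivative_within_imp_increasing[where f = "\<lambda>x. - v' x"])
      show "((\<lambda>x. - v' x) has_real_derivative l * v y + v y powr p) (at y within {x..X})"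
        if y: "y \<in> {x..X}" for y
      proof -
        have "(v' has_real_derivative - (l * v y + v y powr p)) (at y within {x..X})"
          by (rule has_field_derivative_subset[OF D2_left]) (use x y in auto)
        from DERIV_minus[OF this] show ?thesis by (simp add: add.commute)
      qed
      show "0 < l * v y + v y powr p" if "y \<in> {x<..<X}" for y
        using that x X pos[of y] l by (auto intro!: add_pos_pos mult_pos_pos)
    qed (use x False in auto)
    then show ?thesis using v'X by simp
  qed (use v'X in simp)
  have v_mono: "v x < v y" if "0 \<le> x" "x < y" "y \<le> X" for x y
    by (rule has_real_derivative_within_imp_increasing[of _ _ _ v'])
      (use that X in \<open>auto intro!: Dsub v'pos\<close>)
  show z: "v x / b \<in> {0..k}" if x: "x \<in> {0..X}" for x
    using nonneg[of x] v_mono[of x X] x b k X vX(1)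
    by (cases "x = X") (auto simp: field_simps intro: less_imp_le)
  show "v x / b < k" if x: "x \<in> {0..<X}" for x
    using v_mono[of x X] x b vX(1) by (auto simp: field_simps)

  show "((\<lambda>x. v x / b) has_real_derivative sqrt (slope_sq p l M k (v x / b))) (at x within {0..X})"
    if x: "x \<in> {0..X}" for x
  proof -
    \<comment> \<open>\<open>E\<close> is the conserved energy of the nonlinear equation. Its value
      at \<open>X\<close> is read off from the cosine arc, whose kinetic and quadratic parts add up
      to \<open>b\<^sup>2 * l\<close>.\<close>
    define E where "E x = (v' x)\<^sup>2 + l * (v x)\<^sup>2 + 2 / (p + 1) * v x powr (p + 1)" for x
    have "E x = E X"
    proof (rule has_real_derivative_within_zero_imp_const[where f = E, OF _ x])
      fix y assume y: "y \<in> {0..X}"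
      have Dy: "(v has_real_derivative v' y) (at y within {0..X})" using y X by (intro Dsub) auto
      have "((\<lambda>y. v y powr (p + 1)) has_real_derivative (p + 1) * v y powr (p + 1 - 1) * v' y)
          (at y within {0..X})"
        by (rule has_real_derivative_powr_comp_nonneg[OF _ Dy]) (use p y X nonneg in auto)
      moreover have "2 / (p + 1) * ((p + 1) * v y powr (p + 1 - 1) * v' y) = 2 * v y powr p * v' y"
        using p by simp
      ultimately have Dp: "((\<lambda>y. 2 / (p + 1) * v y powr (p + 1)) has_real_derivative 2 * v y powr p * v' y)
          (at y within {0..X})"
        using DERIV_cmult by metis
      have "(E has_real_derivative
          2 * v' y * (- (l * v y + v y powr p)) + l * (2 * v y * v' y) + 2 * v y powr p * v' y)
          (at y within {0..X})"
        unfolding E_def [abs_def]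
        using D2_left[OF y] Dy by (intro DERIV_add[OF _ Dp]) (auto intro!: derivative_eq_intros)
      then show "(E has_real_derivative 0) (at y within {0..X})"
        by (simp add: algebra_simps)
    qed (use X in auto)
    also have "E X = b\<^sup>2 * l * ((sin (s * h / 2))\<^sup>2 + (cos (s * h / 2))\<^sup>2)
        + 2 / (p + 1) * (b * k) powr (p + 1)"
    proof -
      have "k = cos (s * h / 2)" by (simp add: k_def s_def)
      then show ?thesis
        unfolding E_def vX s(3)[symmetric] by (simp only: power2_eq_square algebra_simps)
    qed
    also have "(sin (s * h / 2))\<^sup>2 + (cos (s * h / 2))\<^sup>2 = 1" by simp
    finally have en: "(v' x)\<^sup>2 = b\<^sup>2 * l + 2 / (p + 1) * (b * k) powr (p + 1)
        - l * (v x)\<^sup>2 - 2 / (p + 1) * v x powr (p + 1)"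
      by (simp add: E_def)
    define z where "z = v x / b"
    have z0: "z \<ge> 0" and vz: "v x = b * z" using z[OF x] b by (auto simp: z_def)
    \<comment> \<open>This identity lets \<open>b\<^sup>2\<close> be factored out of the energy,
      leaving the power \<open>b powr (p - 1)\<close> that is absorbed into
      \<open>M\<close>.\<close>
    have b2: "b powr (1 + p) = b\<^sup>2 * b powr (p - 1)"
      using b by (simp add: powr_add powr_diff power2_eq_square)
    have "(v' x)\<^sup>2 = b\<^sup>2 * slope_sq p l M k z"
      unfolding en vz slope_sq_def M_def using b k z0
      by (simp add: powr_mult b2 power_mult_distrib algebra_simps diff_divide_distrib)
    then have "(v' x / b)\<^sup>2 = slope_sq p l M k z" using b by (simp add: power_divide)
    then have "sqrt (slope_sq p l M k z) = v' x / b"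
      using v'pos[OF x] b by (intro real_sqrt_unique) auto
    moreover have "((\<lambda>x. v x / b) has_real_derivative v' x / b) (at x within {0..X})"
      using x X by (intro DERIV_cdivide Dsub) auto
    ultimately show ?thesis by (simp add: z_def)
  qed
qed

text \<open>The travel time \<open>?T\<close> for the amplitude of \<open>u\<close> serves as a
  clock: along \<open>u / b\<close> it shows exactly the position \<open>y\<close>. If
  \<open>v\<close> had larger amplitude, the same clock along \<open>v / c\<close> would gain
  strictly, although both profiles reach height \<open>k\<close> at the same \<open>X\<close>. Once
  the amplitudes agree, the clock is exact along both and injectivity identifies them.\<close>

lemma sym_pos_solution_unique_aux:
  fixes p l h :: real and u v :: "real \<Rightarrow> real"
  assumes p: "p > 1" and l: "0 < l" "l < pi\<^sup>2" and h: "0 < h" "h < 1"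
    and u: "is_sym_pos_solution p l h u" and v: "is_sym_pos_solution p l h v"
    and le: "u (1/2) \<le> v (1/2)" and x: "x \<in> {0..1/2}"
  shows "u x = v x"
proof -
  define X where "X = (1 - h) / 2"
  define k where "k = cos (sqrt l * h / 2)"
  define M where "M b = 2 * b powr (p - 1) / (p + 1)" for b
  define b c where "b = u (1/2)" and "c = v (1/2)"
  note U = sym_pos_solution_profile[OF p l h u, folded X_def k_def b_def M_def]
  note V = sym_pos_solution_profile[OF p l h v, folded X_def k_def c_def M_def]
  have X: "0 < X" using h by (simp add: X_def)
  have u0: "u 0 = 0" and v0: "v 0 = 0"
    using u v unfolding is_sym_pos_solution_def is_solution_def by blast+
  have uX: "u X / b = k" and vX: "v X / c = k"
    using U(1) U(4)[of X] V(1) V(4)[of X] h by (auto simp: X_def k_def field_simps)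
  let ?T = "travel_time p l (M b) k"
  have M: "M b \<ge> 0" using p by (simp add: M_def)
  have slope: "slope_sq p l (M b) k w > 0" if "w \<in> {0..k}" for w
    using slope_sq_pos[OF p l(1) M] that U(3) by simp
  \<comment> \<open>Rate at which the clock gains on the position along an arbitrary profile
    \<open>f\<close> with slope \<open>d\<close>.\<close>
  have TD: "((\<lambda>x. ?T (f x) - x) has_real_derivative
      1 / sqrt (slope_sq p l (M b) k (f y)) * d - 1) (at y within {0..X})"
    if f: "\<And>x. x \<in> {0..X} \<Longrightarrow> f x \<in> {0..k}" and d: "(f has_real_derivative d) (at y within {0..X})"
      and y: "y \<in> {0..X}" for f d y
  proof -
    have "(?T has_real_derivative 1 / sqrt (slope_sq p l (M b) k (f y))) (at (f y) within f ` {0..X})"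
      by (rule has_field_derivative_subset[OF travel_time_deriv[OF p l(1) M U(2,3)]]) (use f y in auto)
    from DERIV_image_chain[OF this d] show ?thesis
      by (auto intro!: derivative_eq_intros simp: o_def)
  qed
  have Tu: "?T (u y / b) = y" if y: "y \<in> {0..X}" for y
  proof -
    have "?T (u y / b) - y = ?T (u 0 / b) - 0"
    proof (rule has_real_derivative_within_zero_imp_const[where f = "\<lambda>y. ?T (u y / b) - y", OF _ y])
      show "((\<lambda>y. ?T (u y / b) - y) has_real_derivative 0) (at t within {0..X})" if t: "t \<in> {0..X}" for t
        using TD[OF U(5) U(7)[OF t] t] slope[OF U(5)[OF t]] by simp
    qed (use X in auto)
    then show ?thesis by (simp add: u0 travel_time_def)
  qed
  have "b = c"
  proof (rule ccontr)
    assume "b \<noteq> c"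
    then have "b < c" using le by (simp add: b_def c_def)
    then have Mbc: "M b < M c"
      using U(1) p by (auto simp: M_def intro!: divide_strict_right_mono powr_less_mono2)
    \<comment> \<open>The two slopes agree at height \<open>k\<close>; the strict gain comes from
      interior points, where \<open>v t / c < k\<close>.\<close>
    have "?T (v 0 / c) - 0 < ?T (v X / c) - X"
    proof (rule has_real_derivative_within_imp_increasing[OF X TD[OF V(5) V(7)]])
      fix t assume t: "t \<in> {0<..<X}"
      have z: "0 \<le> v t / c" "v t / c < k" using V(5)[of t] V(6)[of t] t by auto
      have "(v t / c) powr (p + 1) < k powr (p + 1)"
        using z p by (intro powr_less_mono2) auto
      then have "slope_sq p l (M b) k (v t / c) < slope_sq p l (M c) k (v t / c)"
        using Mbc unfolding slope_sq_def by (intro add_strict_left_mono mult_strict_right_mono) auto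
      then show "0 < 1 / sqrt (slope_sq p l (M b) k (v t / c)) * sqrt (slope_sq p l (M c) k (v t / c)) - 1"
        using slope[of "v t / c"] z by (simp add: field_simps)
    qed auto
    moreover have "?T k = X" using Tu[of X] uX X by simp
    ultimately show False by (simp add: v0 vX travel_time_def)
  qed
  show ?thesis
  proof (cases "x \<le> X")
    case True
    have x': "x \<in> {0..X}" using x True by auto
    have "?T (v x / b) - x = ?T (v 0 / b) - 0"
    proof (rule has_real_derivative_within_zero_imp_const[where f = "\<lambda>y. ?T (v y / b) - y", OF _ x'])
      show "((\<lambda>y. ?T (v y / b) - y) has_real_derivative 0) (at t within {0..X})" if t: "t \<in> {0..X}" for t
        using TD[OF V(5) V(7)[OF t] t] slope[OF V(5)[OF t]] \<open>b = c\<close> by simp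
    qed (use X in auto)
    then have "?T (v x / b) = ?T (u x / b)" using Tu[OF x'] by (simp add: v0 travel_time_def)
    then have "v x / b = u x / b"
      using travel_time_inj[OF p l(1) M U(2,3)] U(5)[OF x'] V(5)[OF x'] \<open>b = c\<close> by blast
    then show ?thesis using U(1) by simp
  next
    case False
    then show ?thesis using U(4)[of x] V(4)[of x] x \<open>b = c\<close> by auto
  qed
qed

text \<open>The two solutions can be exchanged, so either order of amplitudes is covered; reflection
  then extends equality from the left half to the whole interval.\<close>

lemma sym_pos_solution_unique:
  fixes p l h :: real and u v :: "real \<Rightarrow> real"
  assumes "p > 1" "0 < l" "l < pi\<^sup>2" "0 < h" "h < 1"
    and u: "is_sym_pos_solution p l h u" and v: "is_sym_pos_solution p l h v"
    and x: "x \<in> {0..1}"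
  shows "u x = v x"
proof -
  have half: "u y = v y" if "y \<in> {0..1/2}" for y
    using sym_pos_solution_unique_aux[OF assms(1-5) u v _ that]
      sym_pos_solution_unique_aux[OF assms(1-5) v u _ that] by linarith
  have "u x = u (1 - x)" "v x = v (1 - x)"
    using u v x unfolding is_sym_pos_solution_def by blast+
  then show ?thesis using half[of x] half[of "1 - x"] x by (cases "x \<le> 1/2") auto
qed

subsection \<open>Construction of solutions\<close>

text \<open>Equal values and equal one-sided derivatives at the joint suffice. It is applied at the
  interface \<open>X\<close> and at the midpoint.\<close>

lemma has_real_derivative_glue:
  fixes f g :: "real \<Rightarrow> real"
  assumes f: "\<And>x. x \<in> {a..b} \<Longrightarrow> (f has_real_derivative f' x) (at x within {a..b})"
    and g: "\<And>x. x \<in> {b..c} \<Longrightarrow> (g has_real_derivative g' x) (at x within {b..c})"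
    and eq: "f b = g b" "f' b = g' b" and ab: "a \<le> b" "b \<le> c" and x: "x \<in> {a..c}"
  shows "((\<lambda>x. if x \<le> b then f x else g x) has_real_derivative (if x \<le> b then f' x else g' x))
    (at x within {a..c})" (is "(?F has_real_derivative ?F' x) _")
proof -
  have F1: "(?F has_real_derivative ?F' y) (at y within {a..b})" if y: "y \<in> {a..b}" for y
  proof (rule has_field_derivative_transform_within[OF _ zero_less_one y])
    show "(f has_real_derivative ?F' y) (at y within {a..b})" using f[OF y] y by simp
  qed auto
  have F2: "(?F has_real_derivative ?F' y) (at y within {b..c})" if y: "y \<in> {b..c}" for y
  proof (rule has_field_derivative_transform_within[OF _ zero_less_one y])
    show "(g has_real_derivative ?F' y) (at y within {b..c})" using g[OF y] y eq by (cases "y = b") auto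
    show "g z = ?F z" if "z \<in> {b..c}" for z using that eq by (cases "z = b") auto
  qed
  consider "x < b" | "x = b" | "x > b" by linarith
  then show ?thesis
  proof cases
    case 1
    then have "at x within {a..c} = at x within {a..b}"
      using ab by (intro at_within_nhd[of x "{..<b}"]) auto
    then show ?thesis using F1[of x] 1 x by simp
  next
    case 2
    have "{a..c} = {a..b} \<union> {b..c}" using ab by auto
    then show ?thesis
      using F1[of x] F2[of x] 2 ab unfolding has_field_derivative_iff by (simp add: Lim_within_Un)
  next
    case 3
    then have "at x within {a..c} = at x within {b..c}"
      using ab by (intro at_within_nhd[of x "{b<..}"]) auto
    then show ?thesis using F2[of x] 3 x by simp
  qed
qed

text \<open>The width \<open>h\<close> is chosen so that the cosine arc descends from 1 to
  \<open>k\<close> over a distance \<open>h / 2\<close>; \<open>time\<close> says that the nonlinear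
  arc climbs from 0 to \<open>k\<close> over the remaining length. The two arcs are joined, scaled
  by \<alpha> and reflected. The formulas for \<open>u'\<close> are recorded for the convergence
  estimate.\<close>

lemma sym_pos_solution_exists:
  fixes p \<alpha> k l :: real
  assumes p: "p > 1" and \<alpha>: "\<alpha> > 0" and k: "0 < k" "k < 1" and l: "0 < l" "l < pi\<^sup>2"
  defines "M \<equiv> 2 * \<alpha> powr (p - 1) / (p + 1)" and "h \<equiv> 2 * arccos k / sqrt l"
  defines "X \<equiv> (1 - h) / 2"
  assumes time: "travel_time p l M k k = X"
  obtains u u' where "is_sym_pos_solution p l h u"
    and "\<And>x. x \<in> {0..1} \<Longrightarrow> (u has_real_derivative u' x) (at x within {0..1})"
    and "\<And>x. x \<in> {0..1} \<Longrightarrow> \<bar>u x\<bar> \<le> \<alpha>" and "u (1/2) = \<alpha>"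
    and "\<And>x. x \<in> {0..X} \<Longrightarrow> \<exists>w\<in>{0..k}. u' x = \<alpha> * sqrt (slope_sq p l M k w)"
    and "\<And>x. x \<in> {X..1/2} \<Longrightarrow> u' x = \<alpha> * (sqrt l * sin (sqrt l * (1/2 - x)))"
    and "\<And>x. x \<in> {0..1/2} \<Longrightarrow> u' (1 - x) = - u' x"
proof -
  have M: "M > 0" using p \<alpha> by (simp add: M_def)
  define s where "s = sqrt l"
  have s: "0 < s" "s * s = l" using l by (auto simp: s_def)
  have ac: "0 < arccos k" "arccos k < pi / 2"
    using arccos_lt_bounded[of k] arccos_less_arccos[of 0 k] k by auto
  have h: "h > 0" using ac s by (simp add: h_def s_def)
  \<comment> \<open>A positive travel time is what guarantees \<open>h < 1\<close>.\<close>
  have X0: "0 < X"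
    using travel_time_strict_mono[OF p l(1) less_imp_le[OF M] k, of 0 k] k time
    by (simp add: travel_time_def)
  have X: "X < 1/2" "1 - X > 1/2" using h by (auto simp: X_def)
  have sX: "s * (1/2 - X) = arccos k"
  proof -
    have "1/2 - X = arccos k / s" by (simp add: X_def h_def s_def field_simps)
    then show ?thesis using s by simp
  qed
  obtain \<phi> where \<phi>0: "\<phi> 0 = 0" and \<phi>X: "\<phi> X = k"
    and \<phi>: "\<And>x. x \<in> {0..X} \<Longrightarrow> \<phi> x \<in> {0..k} \<and> travel_time p l M k (\<phi> x) = x"
    and D\<phi>: "\<And>x. x \<in> {0..X} \<Longrightarrow>
      (\<phi> has_real_derivative sqrt (slope_sq p l M k (\<phi> x))) (at x within {0..X})"
    using travel_time_inverse[OF p l(1) less_imp_le[OF M] k] unfolding time by blast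
  define \<sigma> where "\<sigma> x = sqrt (slope_sq p l M k (\<phi> x))" for x
  \<comment> \<open>The slopes match at the interface: at height \<open>k\<close> the nonlinear term
    drops out and \<open>slope_sq\<close> becomes \<open>l * (1 - k\<^sup>2)\<close>, where
    \<open>sqrt (1 - k\<^sup>2) = sin (arccos k)\<close>.\<close>
  have \<sigma>X: "\<sigma> X = s * sin (s * (1/2 - X))"
    unfolding sX using k by (simp add: \<sigma>_def \<phi>X slope_sq_def real_sqrt_mult s_def sin_arccos_abs)
  \<comment> \<open>\<open>\<rho>\<close> is half the height derivative of \<open>slope_sq\<close>.
    Differentiating the first-order equation cancels the square root and recovers the second-order
    equation.\<close>
  define \<rho> where "\<rho> x = - (l * \<phi> x + M * (p + 1) / 2 * \<phi> x powr p)" for x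
  have D\<sigma>: "(\<sigma> has_real_derivative \<rho> x) (at x within {0..X})" if x: "x \<in> {0..X}" for x
  proof -
    let ?D = "- 2 * l * \<phi> x - M * (p + 1) * \<phi> x powr p"
    have pos: "slope_sq p l M k (\<phi> x) > 0"
      using slope_sq_pos[OF p l(1), of M "\<phi> x" k] \<phi>[OF x] M k by simp
    have "(slope_sq p l M k has_real_derivative ?D) (at (\<phi> x) within \<phi> ` {0..X})"
      by (rule has_field_derivative_subset[OF slope_sq_deriv[OF p]]) (use \<phi> x in blast)+
    from DERIV_image_chain[OF this D\<phi>[OF x]]
    have "((\<lambda>x. slope_sq p l M k (\<phi> x)) has_real_derivative ?D * \<sigma> x) (at x within {0..X})"
      by (simp add: o_def \<sigma>_def)
    from DERIV_chain'[OF this DERIV_real_sqrt[OF pos]]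
    have "(\<sigma> has_real_derivative inverse (sqrt (slope_sq p l M k (\<phi> x))) / 2 * (?D * \<sigma> x)) (at x within {0..X})"
      by (simp add: \<sigma>_def [abs_def] mult.commute)
    moreover have "inverse (sqrt (slope_sq p l M k (\<phi> x))) / 2 * (?D * \<sigma> x) = \<rho> x"
      using pos by (simp add: \<sigma>_def \<rho>_def field_simps)
    ultimately show ?thesis by simp
  qed
  have Dcos: "((\<lambda>x. cos (s * (1/2 - x))) has_real_derivative s * sin (s * (1/2 - x))) (at x within S)" for x S
    by (auto intro!: derivative_eq_intros)
  have Dsin: "((\<lambda>x. s * sin (s * (1/2 - x))) has_real_derivative - l * cos (s * (1/2 - x))) (at x within S)" for x S
    using s by (auto intro!: derivative_eq_intros)

  define z where "z x = (if x \<le> X then \<phi> x else cos (s * (1/2 - x)))" for x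
  define z' where "z' x = (if x \<le> X then \<sigma> x else s * sin (s * (1/2 - x)))" for x
  have zX: "\<phi> X = cos (s * (1/2 - X))" using k by (simp add: \<phi>X sX)
  have Dz: "(z has_real_derivative z' x) (at x within {0..1/2})" if "x \<in> {0..1/2}" for x
    unfolding z_def [abs_def] z'_def
    by (rule has_real_derivative_glue) (use that X X0 D\<phi> zX \<sigma>X Dcos in \<open>auto simp: \<sigma>_def\<close>)
  have z_half: "z (1/2) = 1" "z' (1/2) = 0" using X by (auto simp: z_def z'_def)
  have z_bound: "0 \<le> z x \<and> z x \<le> 1 \<and> (0 < x \<longrightarrow> 0 < z x)" if x: "x \<in> {0..1/2}" for x
  proof (cases "x \<le> X")
    case True
    then have x': "x \<in> {0..X}" using x by simp
    have "\<phi> x \<noteq> 0" if "x \<noteq> 0"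
      using \<phi>[OF x'] that by (auto simp: travel_time_def)
    then show ?thesis using True \<phi>[OF x'] k by (auto simp: z_def)
  next
    case False
    have "0 \<le> s * (1/2 - x)" using s x by simp
    moreover have "s * (1/2 - x) < pi / 2"
      using mult_strict_left_mono[of "1/2 - x" "1/2 - X" s] False s sX ac by simp
    ultimately have "0 < cos (s * (1/2 - x))" by (intro cos_gt_zero_pi) auto
    then show ?thesis using False by (simp add: z_def)
  qed

  \<comment> \<open>As heights lie between 0 and 1, \<open>C\<close> bounds the second derivative on
    both arcs. The resulting Lipschitz bound yields absolute continuity of
    \<open>u'\<close>.\<close>
  define C where "C = l + M * (p + 1) / 2"
  have C: "C \<ge> l" "C \<ge> 0" using l M p by (auto simp: C_def)
  have "C-lipschitz_on {0..X} \<sigma>"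
  proof (rule real_derivative_bounded_imp_lipschitz_on[OF D\<sigma> _ C(2)])
    fix x assume x: "x \<in> {0..X}"
    have w: "0 \<le> \<phi> x" "\<phi> x \<le> 1" using \<phi>[OF x] k by auto
    then have "\<phi> x powr p \<le> 1" using powr_mono2[of p "\<phi> x" 1] p by simp
    then have "l * \<phi> x \<le> l * 1" "M * (p + 1) / 2 * \<phi> x powr p \<le> M * (p + 1) / 2 * 1"
      using l M p w by (intro mult_left_mono; simp)+
    moreover have "0 \<le> l * \<phi> x" "0 \<le> M * (p + 1) / 2 * \<phi> x powr p"
      using l M p w by auto
    ultimately show "\<bar>\<rho> x\<bar> \<le> C" by (simp add: \<rho>_def C_def)
  qed
  moreover have "C-lipschitz_on {X..1/2} (\<lambda>x. s * sin (s * (1/2 - x)))"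
  proof (rule real_derivative_bounded_imp_lipschitz_on[OF Dsin _ C(2)])
    fix x
    have "l * \<bar>cos (s * (1/2 - x))\<bar> \<le> l * 1"
      using l by (intro mult_left_mono abs_cos_le_one) simp
    moreover have "\<bar>- l * cos (s * (1/2 - x))\<bar> = l * \<bar>cos (s * (1/2 - x))\<bar>"
      using l by (simp add: abs_mult)
    ultimately show "\<bar>- l * cos (s * (1/2 - x))\<bar> \<le> C"
      using C(1) by linarith
  qed
  ultimately have lip: "C-lipschitz_on {0..1/2} z'"
    unfolding z'_def [abs_def] by (rule lipschitz_on_concat) (rule \<sigma>X)

  define u where "u x = (if x \<le> 1/2 then \<alpha> * z x else \<alpha> * z (1 - x))" for x
  define u' where "u' x = (if x \<le> 1/2 then \<alpha> * z' x else - \<alpha> * z' (1 - x))" for x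
  have usym: "u (1 - x) = u x" for x
  proof (cases "x = 1/2")
    case True
    show ?thesis unfolding True by simp
  qed (auto simp: u_def)
  \<comment> \<open>Away from the midpoint the branches are exchanged; at the midpoint the identity
    holds because \<open>z' (1/2) = 0\<close>.\<close>
  have u'sym: "u' (1 - x) = - u' x" for x
  proof (cases "x = 1/2")
    case True
    show ?thesis unfolding True using z_half by (simp add: u'_def)
  qed (auto simp: u'_def)
  have Du: "(u has_real_derivative u' x) (at x within {0..1})" if x: "x \<in> {0..1}" for x
    unfolding u_def [abs_def] u'_def
  proof (rule has_real_derivative_glue)
    show "((\<lambda>x. \<alpha> * z x) has_real_derivative \<alpha> * z' y) (at y within {0..1/2})" if "y \<in> {0..1/2}" for y
      by (rule DERIV_cmult[OF Dz[OF that]])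
    show "((\<lambda>x. \<alpha> * z (1 - x)) has_real_derivative - \<alpha> * z' (1 - y)) (at y within {1/2..1})"
      if y: "y \<in> {1/2..1}" for y
    proof -
      have "(z has_real_derivative z' (1 - y)) (at (1 - y) within (\<lambda>x. 1 - x) ` {1/2..1})"
        by (rule has_field_derivative_subset[OF Dz]) (use y in auto)
      moreover have "((\<lambda>x. 1 - x) has_real_derivative - 1) (at y within {1/2..1})"
        by (auto intro!: derivative_eq_intros)
      ultimately have "(z \<circ> (\<lambda>x. 1 - x) has_real_derivative z' (1 - y) * - 1) (at y within {1/2..1})"
        by (rule DERIV_image_chain)
      from DERIV_cmult[OF this, of \<alpha>] show ?thesis by (simp add: o_def)
    qed
  qed (use x z_half in auto)

  have "(\<alpha> * C)-lipschitz_on {0..1/2} (\<lambda>x. \<alpha> * z' x)"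
    using lipschitz_on_cmult_real[OF lip, of \<alpha>] \<alpha> by simp
  moreover have "(\<alpha> * C)-lipschitz_on {1/2..1} (\<lambda>x. - \<alpha> * z' (1 - x))"
  proof (rule lipschitz_onI)
    fix x y :: real assume "x \<in> {1/2..1}" "y \<in> {1/2..1}"
    then have "dist (z' (1 - x)) (z' (1 - y)) \<le> C * dist (1 - x) (1 - y)"
      by (intro lipschitz_onD[OF lip]) auto
    then have "\<alpha> * \<bar>z' (1 - x) - z' (1 - y)\<bar> \<le> \<alpha> * (C * \<bar>x - y\<bar>)"
      using \<alpha> by (intro mult_left_mono) (auto simp: dist_real_def abs_minus_commute)
    moreover have "dist (- \<alpha> * z' (1 - x)) (- \<alpha> * z' (1 - y)) = \<alpha> * \<bar>z' (1 - x) - z' (1 - y)\<bar>"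
    proof -
      have "- \<alpha> * z' (1 - x) - - \<alpha> * z' (1 - y) = - (\<alpha> * (z' (1 - x) - z' (1 - y)))"
        by (simp add: algebra_simps)
      then show ?thesis
        using \<alpha> by (simp only: dist_real_def abs_minus_cancel abs_mult abs_of_pos)
    qed
    ultimately show "dist (- \<alpha> * z' (1 - x)) (- \<alpha> * z' (1 - y)) \<le> \<alpha> * C * dist x y"
      by (simp add: dist_real_def)
  qed (use \<alpha> C in simp)
  ultimately have lip': "(\<alpha> * C)-lipschitz_on {0..1} u'"
    unfolding u'_def [abs_def] by (rule lipschitz_on_concat) (use z_half in simp)

  have D2_left: "(u' has_real_derivative - (l * u x + a_h h x * u x powr p)) (at x)"
    if x: "0 < x" "x < 1/2" "x \<noteq> X" for x
  proof (cases "x < X")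
    case True
    have "(\<sigma> has_real_derivative \<rho> x) (at x)"
      using D\<sigma>[of x] at_within_interior[of x "{0..X}"] True x by simp
    then have "((\<lambda>x. \<alpha> * \<sigma> x) has_real_derivative \<alpha> * \<rho> x) (at x)" by (rule DERIV_cmult)
    then have "(u' has_real_derivative \<alpha> * \<rho> x) (at x)"
    proof (rule has_field_derivative_transform_within_open)
      show "\<alpha> * \<sigma> y = u' y" if "y \<in> {0<..<X}" for y
        using that X by (simp add: u'_def z'_def)
    qed (use True x in auto)
    moreover have "\<alpha> * \<rho> x = - (l * u x + a_h h x * u x powr p)"
    proof -
      have ux: "u x = \<alpha> * \<phi> x" using True x by (simp add: u_def z_def)
      have ah: "a_h h x = 1" using True by (simp add: a_h_def X_def)
      \<comment> \<open>The definition of \<open>M\<close> is designed for this: undoing the scaling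
        by \<alpha> restores coefficient 1 in front of the power.\<close>
      have e1: "\<alpha> * (M * (p + 1) / 2) = \<alpha> powr p"
        using p \<alpha> by (simp add: M_def powr_diff)
      have e2: "(\<alpha> * \<phi> x) powr p = \<alpha> powr p * \<phi> x powr p"
        using \<phi>[of x] True x \<alpha> by (simp add: powr_mult)
      have "\<alpha> * \<rho> x = - (l * (\<alpha> * \<phi> x) + \<alpha> * (M * (p + 1) / 2) * \<phi> x powr p)"
        by (simp add: \<rho>_def algebra_simps)
      then show ?thesis
        unfolding ux ah e1 e2 by simp
    qed
    ultimately show ?thesis by simp
  next
    case False
    then have "X < x" using x by simp
    have "((\<lambda>x. \<alpha> * (s * sin (s * (1/2 - x)))) has_real_derivative \<alpha> * (- l * cos (s * (1/2 - x)))) (at x)"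
      by (rule DERIV_cmult[OF Dsin])
    then have "(u' has_real_derivative \<alpha> * (- l * cos (s * (1/2 - x)))) (at x)"
    proof (rule has_field_derivative_transform_within_open)
      show "\<alpha> * (s * sin (s * (1/2 - y))) = u' y" if "y \<in> {X<..<1/2}" for y
        using that by (simp add: u'_def z'_def)
    qed (use \<open>X < x\<close> x in auto)
    moreover have "a_h h x = 0" using \<open>X < x\<close> x h by (simp add: a_h_def X_def)
    ultimately show ?thesis using \<open>X < x\<close> x by (simp add: u_def z_def mult.left_commute)
  qed
  have D2_right: "(u' has_real_derivative - (l * u x + a_h h x * u x powr p)) (at x)"
    if x: "1/2 < x" "x < 1" "x \<noteq> 1 - X" for x
  proof -
    have "(u' has_real_derivative - (l * u (1 - x) + a_h h (1 - x) * u (1 - x) powr p)) (at (1 - x))"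
      using x by (intro D2_left) auto
    moreover have "a_h h (1 - x) = a_h h x" by (auto simp: a_h_def field_simps)
    ultimately have "(u' has_real_derivative - (l * u x + a_h h x * u x powr p)) (at (1 - x))"
      by (simp add: usym)
    then have "((\<lambda>x. u' (1 - x)) has_real_derivative - (l * u x + a_h h x * u x powr p) * - 1) (at x)"
      by (rule DERIV_chain'[rotated]) (auto intro!: derivative_eq_intros)
    then have "((\<lambda>x. - u' x) has_real_derivative l * u x + a_h h x * u x powr p) (at x)"
      unfolding u'sym by (simp add: add.commute)
    from DERIV_minus[OF this] show ?thesis by simp
  qed
  \<comment> \<open>The weight jumps at \<open>X\<close> and \<open>1 - X\<close>, and the reflected
    branches meet at \<open>1/2\<close>; these three points form a null set.\<close>
  have "AE x in lebesgue. x \<notin> {X, 1/2, 1 - X}"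
    by (intro AE_not_in) (auto simp flip: negligible_iff_null_sets)
  then have ae: "AE x in lebesgue. x \<in> {0<..<1} \<longrightarrow>
      (u' has_real_derivative - (l * u x + a_h h x * u x powr p)) (at x)"
  proof (rule AE_mp, intro AE_I2 impI)
    fix x assume "x \<notin> {X, 1/2, 1 - X}" "x \<in> {0<..<1}"
    then show "(u' has_real_derivative - (l * u x + a_h h x * u x powr p)) (at x)"
      using D2_left[of x] D2_right[of x] by (cases "x < 1/2") auto
  qed
  have u01: "u 0 = 0" "u 1 = 0" using X0 by (auto simp: u_def z_def \<phi>0)
  have sol: "is_solution p l h u"
    unfolding is_solution_def
    using Du lipschitz_on_continuous_on[OF lip'] lipschitz_on_imp_abs_continuous_on[OF lip'] ae u01 by blast
  show thesis
  proof (rule that)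
    show "is_sym_pos_solution p l h u"
      unfolding is_sym_pos_solution_def
    proof (intro conjI ballI sol)
      show "u x > 0" if "x \<in> {0<..<1}" for x
        using z_bound[of x] z_bound[of "1 - x"] that \<alpha> by (auto simp: u_def)
      show "u x = u (1 - x)" for x by (rule usym[symmetric])
    qed
    show "\<bar>u x\<bar> \<le> \<alpha>" if "x \<in> {0..1}" for x
      using z_bound[of x] z_bound[of "1 - x"] that \<alpha> by (auto simp: u_def abs_mult mult_left_le)
    show "u (1/2) = \<alpha>" by (simp add: u_def z_half)
    show "\<exists>w\<in>{0..k}. u' x = \<alpha> * sqrt (slope_sq p l M k w)" if "x \<in> {0..X}" for x
      using \<phi>[OF that] that X by (intro bexI[of _ "\<phi> x"]) (auto simp: u'_def z'_def \<sigma>_def)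
    show "u' x = \<alpha> * (sqrt l * sin (sqrt l * (1/2 - x)))" if "x \<in> {X..1/2}" for x
      using that \<sigma>X by (cases "x = X") (auto simp: u'_def z'_def s_def)
  qed (use Du u'sym in auto)
qed

subsection \<open>Convergence\<close>

lemma abs_sin_diff_le: "\<bar>sin x - sin y\<bar> \<le> \<bar>x - y\<bar>" for x y :: real
proof -
  have "norm (sin x - sin y) \<le> 1 * norm (x - y)"
    by (rule field_differentiable_bound[of UNIV sin cos]) (auto intro: DERIV_sin)
  then show ?thesis by simp
qed

lemma sin_pi_half_minus: "sin (pi * (1/2 - x)) = cos (pi * x)"
  using sin_cos_eq[of "pi / 2 - pi * x"] by (simp add: algebra_simps)

text \<open>The first error term compares the cosine arcs with frequencies \<open>sqrt l\<close> and
  \<open>pi\<close>, the second compares the slope on the outer interval with \<open>pi\<close>, and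
  the third measures how far \<open>cos (pi * x)\<close> is from 1 there. All three are nonnegative,
  so their sum serves on both regions, and it vanishes as \<open>k\<close> and \<open>X\<close> tend
  to 0 and \<open>l\<close> tends to \<open>pi\<^sup>2\<close>.\<close>

lemma solution_deriv_estimate:
  fixes p \<alpha> k l M X x :: real and u' :: "real \<Rightarrow> real"
  assumes p: "p > 1" and \<alpha>: "\<alpha> > 0" and k: "0 < k" "k < 1" and l: "0 < l" "l < pi\<^sup>2"
    and M: "M > 0" and X: "0 < X" "X < 1/2"
    and left: "\<And>x. x \<in> {0..X} \<Longrightarrow> \<exists>w\<in>{0..k}. u' x = \<alpha> * sqrt (slope_sq p l M k w)"
    and mid: "\<And>x. x \<in> {X..1/2} \<Longrightarrow> u' x = \<alpha> * (sqrt l * sin (sqrt l * (1/2 - x)))"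
    and sym: "\<And>x. x \<in> {0..1/2} \<Longrightarrow> u' (1 - x) = - u' x"
    and x: "x \<in> {0..1}"
  shows "\<bar>u' x - \<alpha> * pi * cos (pi * x)\<bar>
    \<le> \<alpha> * ((1 + pi) * (pi - sqrt l) + (pi\<^sup>2 - l + pi\<^sup>2 * k\<^sup>2 + M * k powr (p + 1)) / pi + pi\<^sup>2 * X)"
    (is "_ \<le> \<alpha> * (?e1 + ?e2 + ?e3)")
proof -
  have s: "0 < sqrt l" "sqrt l < pi" using l real_sqrt_less_mono[of l "pi\<^sup>2"] by auto
  have e: "?e1 \<ge> 0" "?e2 \<ge> 0" "?e3 \<ge> 0"
    using s l M X by (auto intro!: mult_nonneg_nonneg divide_nonneg_nonneg add_nonneg_nonneg)
  have half: "\<bar>u' y - \<alpha> * pi * cos (pi * y)\<bar> \<le> \<alpha> * (?e1 + ?e2 + ?e3)" if y: "y \<in> {0..1/2}" for y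
  proof (cases "y \<le> X")
    case True
    then obtain w where w: "w \<in> {0..k}" and u': "u' y = \<alpha> * sqrt (slope_sq p l M k w)"
      using left[of y] y by auto
    define q where "q = slope_sq p l M k w"
    have "w\<^sup>2 \<le> k\<^sup>2" using w by (intro power_mono) auto
    then have "l * w\<^sup>2 \<le> pi\<^sup>2 * k\<^sup>2" using l by (intro mult_mono) auto
    then have q1: "q \<ge> l - pi\<^sup>2 * k\<^sup>2"
      using slope_sq_ge[of p l M w k] p l M w by (simp add: q_def algebra_simps)
    have "0 \<le> l * w\<^sup>2" "0 \<le> M * w powr (p + 1)" using l M by auto
    then have q2: "q \<le> l + M * k powr (p + 1)" by (simp add: q_def slope_sq_def algebra_simps)
    have "0 \<le> pi\<^sup>2 * k\<^sup>2" "0 \<le> M * k powr (p + 1)" using M by auto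
    then have q3: "\<bar>q - pi\<^sup>2\<bar> \<le> pi\<^sup>2 - l + pi\<^sup>2 * k\<^sup>2 + M * k powr (p + 1)"
      using q1 q2 l by linarith
    have "q > 0" using slope_sq_pos[of p l M w k] p l M w k by (simp add: q_def)
    \<comment> \<open>Because \<open>sqrt q + pi\<close> is at least \<open>pi\<close>, the bound on
      \<open>q - pi\<^sup>2\<close> passes to \<open>sqrt q - pi\<close> after division by
      \<open>pi\<close>.\<close>
    then have "q - pi\<^sup>2 = (sqrt q - pi) * (sqrt q + pi)"
      by (simp add: algebra_simps power2_eq_square flip: real_sqrt_mult)
    then have "\<bar>q - pi\<^sup>2\<bar> = \<bar>sqrt q - pi\<bar> * (sqrt q + pi)"
      using \<open>q > 0\<close> by (simp add: abs_mult)
    moreover have "\<bar>sqrt q - pi\<bar> * pi \<le> \<bar>sqrt q - pi\<bar> * (sqrt q + pi)"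
      using \<open>q > 0\<close> by (intro mult_left_mono) auto
    ultimately have "\<bar>sqrt q - pi\<bar> * pi \<le> pi\<^sup>2 - l + pi\<^sup>2 * k\<^sup>2 + M * k powr (p + 1)"
      using q3 by linarith
    then have r1: "\<bar>sqrt q - pi\<bar> \<le> ?e2" by (simp add: pos_le_divide_eq)
    have "\<bar>sin (pi / 2) - sin (pi * (1/2 - y))\<bar> \<le> \<bar>pi / 2 - pi * (1/2 - y)\<bar>"
      by (rule abs_sin_diff_le)
    also have "pi / 2 - pi * (1/2 - y) = pi * y" by (simp add: algebra_simps)
    also have "\<bar>pi * y\<bar> \<le> pi * X" using y True by (simp add: abs_mult)
    finally have "\<bar>1 - cos (pi * y)\<bar> \<le> pi * X" by (simp only: sin_pi_half_minus sin_pi_half)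
    then have "pi * \<bar>1 - cos (pi * y)\<bar> \<le> pi * (pi * X)" by (intro mult_left_mono) auto
    then have r2: "\<bar>pi * (1 - cos (pi * y))\<bar> \<le> ?e3"
      by (simp add: abs_mult power2_eq_square mult.assoc)
    have "\<bar>(sqrt q - pi) + pi * (1 - cos (pi * y))\<bar> \<le> ?e1 + ?e2 + ?e3"
      using r1 r2 e by linarith
    then have "\<alpha> * \<bar>(sqrt q - pi) + pi * (1 - cos (pi * y))\<bar> \<le> \<alpha> * (?e1 + ?e2 + ?e3)"
      using \<alpha> by (intro mult_left_mono) auto
    moreover have "u' y - \<alpha> * pi * cos (pi * y) = \<alpha> * ((sqrt q - pi) + pi * (1 - cos (pi * y)))"
      by (simp add: u' q_def algebra_simps)
    ultimately show ?thesis using \<alpha> by (simp only: abs_mult abs_of_pos)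
  next
    case False
    define t where "t = 1/2 - y"
    define s where "s = sqrt l"
    have t: "0 \<le> t" "t \<le> 1/2" using y by (auto simp: t_def)
    have "\<bar>sin (s * t) - sin (pi * t)\<bar> \<le> \<bar>s * t - pi * t\<bar>" by (rule abs_sin_diff_le)
    also have "\<dots> = (pi - s) * t" using s t by (simp add: s_def abs_mult flip: left_diff_distrib)
    also have "\<dots> \<le> (pi - s) * 1" using s t by (intro mult_left_mono) (auto simp: s_def)
    finally have "pi * \<bar>sin (s * t) - sin (pi * t)\<bar> \<le> pi * (pi - s)"
      by (intro mult_left_mono) auto
    then have r1: "\<bar>pi * (sin (s * t) - sin (pi * t))\<bar> \<le> pi * (pi - s)" by (simp add: abs_mult)
    have "(pi - s) * \<bar>sin (s * t)\<bar> \<le> (pi - s) * 1"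
      using s by (intro mult_left_mono abs_sin_le_one) (simp add: s_def)
    then have r2: "\<bar>(s - pi) * sin (s * t)\<bar> \<le> pi - s" using s by (simp add: abs_mult s_def)
    \<comment> \<open>The difference \<open>s * sin (s * t) - pi * sin (pi * t)\<close> is split
      into a change of factor and a change of angle.\<close>
    have "\<bar>(s - pi) * sin (s * t) + pi * (sin (s * t) - sin (pi * t))\<bar> \<le> ?e1 + ?e2 + ?e3"
      using r1 r2 e(2,3) by (simp add: algebra_simps flip: s_def)
    then have "\<alpha> * \<bar>(s - pi) * sin (s * t) + pi * (sin (s * t) - sin (pi * t))\<bar> \<le> \<alpha> * (?e1 + ?e2 + ?e3)"
      using \<alpha> by (intro mult_left_mono) auto
    moreover have "u' y - \<alpha> * pi * cos (pi * y)
        = \<alpha> * ((s - pi) * sin (s * t) + pi * (sin (s * t) - sin (pi * t)))"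
      using mid[of y] False y unfolding s_def t_def sin_pi_half_minus by (simp add: algebra_simps)
    ultimately show ?thesis using \<alpha> by (simp only: abs_mult abs_of_pos)
  qed
  \<comment> \<open>Both \<open>u'\<close> and \<open>cos (pi * x)\<close> are odd about the
    midpoint, so the left half decides.\<close>
  show ?thesis
  proof (cases "x \<le> 1/2")
    case True
    then show ?thesis using half[of x] x by simp
  next
    case False
    then have "1 - x \<in> {0..1/2}" using x by simp
    moreover have "cos (pi * (1 - x)) = - cos (pi * x)" by (simp add: right_diff_distrib)
    ultimately show ?thesis using half[of "1 - x"] sym[of "1 - x"] by (simp add: abs_minus_commute)
  qed
qed

section \<open>Selection of the sequences and passage to the limit\<close>

text \<open>Neither limit is attained, so beyond any index there is a later one at which both
  sequences have strictly increased. Iterating that choice from 0 gives the subsequence.\<close>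

lemma strict_mono_common_subseq:
  fixes a b :: "nat \<Rightarrow> real"
  assumes "a \<longlonglongrightarrow> A" "b \<longlonglongrightarrow> B" "\<And>n. a n < A" "\<And>n. b n < B"
  shows "\<exists>r :: nat \<Rightarrow> nat. strict_mono r \<and> strict_mono (\<lambda>n. a (r n)) \<and> strict_mono (\<lambda>n. b (r n))"
proof -
  have "\<exists>m>n. a m > a n \<and> b m > b n" for n
  proof -
    have "eventually (\<lambda>m. m > n \<and> a m > a n \<and> b m > b n) sequentially"
      using order_tendstoD(1)[OF assms(1,3)] order_tendstoD(1)[OF assms(2,4)]
      by (intro eventually_conj eventually_gt_at_top)
    then show ?thesis by (auto simp: eventually_sequentially)
  qed
  then obtain f where f: "\<And>n. f n > n" "\<And>n. a (f n) > a n" "\<And>n. b (f n) > b n" by metis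
  show ?thesis
    by (rule exI[of _ "\<lambda>n. (f ^^ n) 0"]) (auto simp: strict_mono_Suc_iff f)
qed

theorem theorem3p2:
  fixes p :: real and \<alpha> :: real
  assumes "p > 1" and "\<alpha> > 0"
  shows "\<exists>(hs :: nat \<Rightarrow> real) (lams :: nat \<Rightarrow> real) (us :: nat \<Rightarrow> real \<Rightarrow> real).
           strict_mono hs \<and> strict_mono lams \<and>
           (\<forall>n. hs n \<in> {0<..<1} \<and> lams n \<in> {0<..<pi\<^sup>2}) \<and>
           hs \<longlonglongrightarrow> 1 \<and> lams \<longlonglongrightarrow> pi\<^sup>2 \<and>
           (\<forall>n. is_sym_pos_solution p (lams n) (hs n) (us n) \<and>
                (\<forall>v. is_sym_pos_solution p (lams n) (hs n) v \<longrightarrow> (\<forall>x\<in>{0..1}. v x = us n x)) \<and>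
                (SUP x\<in>{0..1}. \<bar>us n x\<bar>) = \<alpha>) \<and>
           uniform_limit {0..1} us (\<lambda>x. \<alpha> * sin (pi * x)) sequentially \<and>
           uniform_limit {0..1} (\<lambda>n x. vector_derivative (us n) (at x within {0..1}))
             (\<lambda>x. \<alpha> * pi * cos (pi * x)) sequentially"
proof -
  define M where "M = 2 * \<alpha> powr (p - 1) / (p + 1)"
  \<comment> \<open>This is the bound of \<open>solution_deriv_estimate\<close> with the interface
    at \<open>(1 - h) / 2\<close>.\<close>
  define err where "err k l h = \<alpha> * ((1 + pi) * (pi - sqrt l)
    + (pi\<^sup>2 - l + pi\<^sup>2 * k\<^sup>2 + M * k powr (p + 1)) / pi + pi\<^sup>2 * ((1 - h) / 2))" for k l h
  have M: "M > 0" using assms by (simp add: M_def)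
  \<comment> \<open>The explicit lower bounds for \<open>l\<close> and \<open>h\<close> are kept
    because they squeeze both parameters to their limits as \<open>k\<close> tends to 0.\<close>
  have "\<exists>l h u u'. (2 * arccos k)\<^sup>2 \<le> l \<and> 0 < l \<and> l < pi\<^sup>2 \<and> 2 * arccos k / pi \<le> h \<and> 0 < h \<and> h < 1 \<and>
      is_sym_pos_solution p l h u \<and>
      (\<forall>x\<in>{0..1}. (u has_real_derivative u' x) (at x within {0..1})) \<and>
      (\<forall>x\<in>{0..1}. \<bar>u x\<bar> \<le> \<alpha>) \<and> u (1/2) = \<alpha> \<and>
      (\<forall>x\<in>{0..1}. \<bar>u' x - \<alpha> * pi * cos (pi * x)\<bar> \<le> err k l h)"
    if k: "0 < k" "k < 1" for k
  proof -
    obtain l where l: "(2 * arccos k)\<^sup>2 \<le> l" "0 < l" "l < pi\<^sup>2"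
      and time: "arccos k / sqrt l + travel_time p l M k k = 1 / 2"
      using exists_parameter_half_period[OF assms(1) M k] by blast
    define h where "h = 2 * arccos k / sqrt l"
    have ac: "0 < arccos k" using arccos_lt_bounded[of k] k by auto
    have s: "0 < sqrt l" "sqrt l < pi" using l real_sqrt_less_mono[of l "pi\<^sup>2"] by auto
    have tX: "travel_time p l M k k = (1 - h) / 2" using time by (simp add: h_def)
    have "0 < travel_time p l M k k"
      using travel_time_strict_mono[OF assms(1) l(2) less_imp_le[OF M] k, of 0 k] k
      by (simp add: travel_time_def)
    then have h: "0 < h" "h < 1" using tX ac s by (auto simp: h_def)
    have "2 * arccos k / pi \<le> h"
      unfolding h_def using ac s by (intro divide_left_mono) auto
    moreover obtain u u' where u: "is_sym_pos_solution p l h u"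
      "\<And>x. x \<in> {0..1} \<Longrightarrow> (u has_real_derivative u' x) (at x within {0..1})"
      "\<And>x. x \<in> {0..1} \<Longrightarrow> \<bar>u x\<bar> \<le> \<alpha>" "u (1/2) = \<alpha>"
      and u': "\<And>x. x \<in> {0..(1 - h) / 2} \<Longrightarrow> \<exists>w\<in>{0..k}. u' x = \<alpha> * sqrt (slope_sq p l M k w)"
      "\<And>x. x \<in> {(1 - h) / 2..1/2} \<Longrightarrow> u' x = \<alpha> * (sqrt l * sin (sqrt l * (1/2 - x)))"
      "\<And>x. x \<in> {0..1/2} \<Longrightarrow> u' (1 - x) = - u' x"
      using sym_pos_solution_exists[OF assms k l(2,3), folded M_def h_def, OF tX] by blast
    moreover have "\<bar>u' x - \<alpha> * pi * cos (pi * x)\<bar> \<le> err k l h" if "x \<in> {0..1}" for x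
      unfolding err_def
      by (rule solution_deriv_estimate[OF assms k l(2,3) M _ _ u' that]) (use h in auto)
    ultimately show ?thesis using l h by blast
  qed
  then obtain L H U U' where LHU: "\<And>k. 0 < k \<Longrightarrow> k < 1 \<Longrightarrow>
      (2 * arccos k)\<^sup>2 \<le> L k \<and> 0 < L k \<and> L k < pi\<^sup>2 \<and> 2 * arccos k / pi \<le> H k \<and> 0 < H k \<and> H k < 1 \<and>
      is_sym_pos_solution p (L k) (H k) (U k) \<and>
      (\<forall>x\<in>{0..1}. (U k has_real_derivative U' k x) (at x within {0..1})) \<and>
      (\<forall>x\<in>{0..1}. \<bar>U k x\<bar> \<le> \<alpha>) \<and> U k (1/2) = \<alpha> \<and>
      (\<forall>x\<in>{0..1}. \<bar>U' k x - \<alpha> * pi * cos (pi * x)\<bar> \<le> err k (L k) (H k))"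
    by metis
  \<comment> \<open>The double successor keeps the height strictly below 1 already at
    \<open>n = 0\<close>.\<close>
  define \<kappa> :: "nat \<Rightarrow> real" where "\<kappa> n = inverse (real (Suc (Suc n)))" for n
  have \<kappa>: "0 < \<kappa> n" "\<kappa> n < 1" for n by (auto simp: \<kappa>_def inverse_less_1_iff)
  note K = LHU[OF \<kappa>]
  have \<kappa>0: "\<kappa> \<longlonglongrightarrow> 0"
    unfolding \<kappa>_def by (rule LIMSEQ_Suc[OF LIMSEQ_inverse_real_of_nat])
  have acos: "(\<lambda>n. arccos (\<kappa> n)) \<longlonglongrightarrow> pi / 2"
  proof -
    have "isCont arccos 0" by (rule isCont_arccos) auto
    from isCont_tendsto_compose[OF this \<kappa>0] show ?thesis by simp
  qed
  have Llim: "(\<lambda>n. L (\<kappa> n)) \<longlonglongrightarrow> pi\<^sup>2"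
  proof (rule tendsto_sandwich)
    show "(\<lambda>n. (2 * arccos (\<kappa> n))\<^sup>2) \<longlonglongrightarrow> pi\<^sup>2"
      using tendsto_power[OF tendsto_mult[OF tendsto_const[of 2] acos], of 2] by simp
    show "(\<lambda>n. pi\<^sup>2) \<longlonglongrightarrow> pi\<^sup>2" by simp
  qed (use K in \<open>auto intro!: always_eventually less_imp_le\<close>)
  have Hlim: "(\<lambda>n. H (\<kappa> n)) \<longlonglongrightarrow> 1"
  proof (rule tendsto_sandwich)
    show "(\<lambda>n. 2 * arccos (\<kappa> n) / pi) \<longlonglongrightarrow> 1"
      using tendsto_divide[OF tendsto_mult[OF tendsto_const[of 2] acos] tendsto_const[of pi]] by simp
    show "(\<lambda>n. 1::real) \<longlonglongrightarrow> 1" by simp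
  qed (use K in \<open>auto intro!: always_eventually less_imp_le\<close>)
  have errlim: "(\<lambda>n. err (\<kappa> n) (L (\<kappa> n)) (H (\<kappa> n))) \<longlonglongrightarrow> 0"
  proof -
    have "(\<lambda>n. \<kappa> n powr (p + 1)) \<longlonglongrightarrow> 0"
      by (rule tendsto_zero_powrI[OF \<kappa>0 tendsto_const])
        (use \<kappa> assms in \<open>auto intro!: always_eventually less_imp_le\<close>)
    then have "(\<lambda>n. err (\<kappa> n) (L (\<kappa> n)) (H (\<kappa> n))) \<longlonglongrightarrow>
        \<alpha> * ((1 + pi) * (pi - sqrt (pi\<^sup>2)) + (pi\<^sup>2 - pi\<^sup>2 + pi\<^sup>2 * 0\<^sup>2 + M * 0) / pi + pi\<^sup>2 * ((1 - 1) / 2))"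
      unfolding err_def by (intro tendsto_intros Llim Hlim \<kappa>0) auto
    then show ?thesis by simp
  qed
  have lt: "H (\<kappa> n) < 1" "L (\<kappa> n) < pi\<^sup>2" for n using K[of n] by blast+
  \<comment> \<open>The intermediate value theorem gives no monotone dependence of \<open>L\<close>
    and \<open>H\<close> on \<open>k\<close>, so strict monotonicity of both is obtained by passing
    to a common subsequence.\<close>
  obtain r :: "nat \<Rightarrow> nat" where r: "strict_mono r"
      "strict_mono (\<lambda>n. H (\<kappa> (r n)))" "strict_mono (\<lambda>n. L (\<kappa> (r n)))"
    using strict_mono_common_subseq[OF Hlim Llim lt] by (elim exE conjE)
  define k where "k n = \<kappa> (r n)" for n
  have subseq: "(\<lambda>n. F (k n)) \<longlonglongrightarrow> y" if "(\<lambda>n. F (\<kappa> n)) \<longlonglongrightarrow> y" for F :: "real \<Rightarrow> real" and y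
    using LIMSEQ_subseq_LIMSEQ[OF that r(1)] by (simp add: o_def k_def)
  note Kk = K[of "r _", folded k_def]
  have small: "eventually (\<lambda>n. err (k n) (L (k n)) (H (k n)) < e) sequentially" if "e > 0" for e
    using order_tendstoD(2)[OF subseq[of "\<lambda>k. err k (L k) (H k)", OF errlim] that] .
  have deriv: "vector_derivative (U (k n)) (at x within {0..1}) = U' (k n) x" if "x \<in> {0..1}" for n x
    using Kk[of n] that
    by (intro vector_derivative_within_closed_interval)
      (auto simp: has_real_derivative_iff_has_vector_derivative)
  \<comment> \<open>The solution and the sine both vanish at 0, so the uniform derivative error,
    accumulated over a length of at most 1, also bounds the error of the values.\<close>
  have U_close: "\<bar>U (k n) x - \<alpha> * sin (pi * x)\<bar> \<le> err (k n) (L (k n)) (H (k n))"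
    if x: "x \<in> {0..1}" for n x
  proof -
    let ?e = "err (k n) (L (k n)) (H (k n))"
    let ?D = "\<lambda>x. U (k n) x - \<alpha> * sin (pi * x)"
    have U'_close: "\<bar>U' (k n) y - \<alpha> * pi * cos (pi * y)\<bar> \<le> ?e" if "y \<in> {0..1}" for y
      using Kk[of n] that by blast
    have e0: "?e \<ge> 0" by (rule order_trans[OF abs_ge_zero U'_close[of 0]]) simp
    have "?e-lipschitz_on {0..1} ?D"
    proof (rule real_derivative_bounded_imp_lipschitz_on[OF _ U'_close e0])
      fix y :: real assume "y \<in> {0..1}"
      then have "(U (k n) has_real_derivative U' (k n) y) (at y within {0..1})"
        using Kk[of n] by blast
      moreover have "((\<lambda>x. \<alpha> * sin (pi * x)) has_real_derivative \<alpha> * pi * cos (pi * y)) (at y within {0..1})"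
        by (auto intro!: derivative_eq_intros)
      ultimately show "(?D has_real_derivative U' (k n) y - \<alpha> * pi * cos (pi * y)) (at y within {0..1})"
        by (rule DERIV_diff)
    qed
    then have "dist (?D x) (?D 0) \<le> ?e * dist x 0"
      by (rule lipschitz_onD) (use x in auto)
    moreover have "U (k n) 0 = 0"
      using Kk[of n] unfolding is_sym_pos_solution_def is_solution_def by blast
    ultimately have "\<bar>?D x\<bar> \<le> ?e * x" using x by (simp add: dist_real_def)
    also have "?e * x \<le> ?e" using e0 x by (simp add: mult_left_le)
    finally show ?thesis .
  qed
  show ?thesis
  proof (intro exI conjI allI impI ballI)
    show "strict_mono (\<lambda>n. H (k n))" "strict_mono (\<lambda>n. L (k n))"
      using r by (simp_all add: o_def k_def)
    show "H (k n) \<in> {0<..<1}" "L (k n) \<in> {0<..<pi\<^sup>2}" "is_sym_pos_solution p (L (k n)) (H (k n)) (U (k n))" for n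
      using Kk[of n] by auto
    show "(\<lambda>n. H (k n)) \<longlonglongrightarrow> 1" "(\<lambda>n. L (k n)) \<longlonglongrightarrow> pi\<^sup>2"
      using subseq Hlim Llim by auto
    show "v x = U (k n) x" if "is_sym_pos_solution p (L (k n)) (H (k n)) v" "x \<in> {0..1}" for n v x
      using sym_pos_solution_unique[OF assms(1) _ _ _ _ that(1) _ that(2)] Kk[of n] by blast
    show "(SUP x\<in>{0..1}. \<bar>U (k n) x\<bar>) = \<alpha>" for n
    proof (rule cSup_eq_maximum)
      show "\<alpha> \<in> (\<lambda>x. \<bar>U (k n) x\<bar>) ` {0..1}"
        using Kk[of n] assms(2) by (intro image_eqI[of _ _ "1/2"]) auto
    qed (use Kk[of n] in auto)
    show "uniform_limit {0..1} (\<lambda>n. U (k n)) (\<lambda>x. \<alpha> * sin (pi * x)) sequentially"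
    proof (rule uniform_limitI)
      fix e :: real assume "e > 0"
      from small[OF this]
      show "\<forall>\<^sub>F n in sequentially. \<forall>x\<in>{0..1}. dist (U (k n) x) (\<alpha> * sin (pi * x)) < e"
      proof eventually_elim
        case (elim n)
        show ?case
          unfolding dist_real_def using le_less_trans[OF U_close elim] by blast
      qed
    qed
    show "uniform_limit {0..1} (\<lambda>n x. vector_derivative (U (k n)) (at x within {0..1}))
        (\<lambda>x. \<alpha> * pi * cos (pi * x)) sequentially"
    proof (rule uniform_limitI)
      fix e :: real assume "e > 0"
      from small[OF this]
      show "\<forall>\<^sub>F n in sequentially. \<forall>x\<in>{0..1}.
          dist (vector_derivative (U (k n)) (at x within {0..1})) (\<alpha> * pi * cos (pi * x)) < e"
      proof eventually_elim
        case (elim n)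
        show ?case
        proof
          fix x :: real assume x: "x \<in> {0..1}"
          then have "\<bar>U' (k n) x - \<alpha> * pi * cos (pi * x)\<bar> \<le> err (k n) (L (k n)) (H (k n))"
            using Kk[of n] by blast
          then show "dist (vector_derivative (U (k n)) (at x within {0..1})) (\<alpha> * pi * cos (pi * x)) < e"
            using elim by (simp add: deriv[OF x] dist_real_def)
        qed
      qed
    qed
  qed
qed

end
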